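(* Let $(\mathcal V,\otimes,k,c)$ be a strict braided monoidal category and let $A$ be a $\mathcal{C}(\mathcal V)$-category with underlying class $X$. Then there is a monoidal structure on the category ${}_A\mathcal V(X)$ of left $A$-modules such that the forgetful functor ${}_A\mathcal V(X)\to\mathcal V(X)$ is monoidal.
   Context: $\mathcal V(X)$ is the category whose objects are families $M=(M_{x,y})_{x,y\in X}$ of objects of $\mathcal V$ and whose morphisms are families of morphisms $\varphi_{x,y}:M_{x,y}\to N_{x,y}$ in $\mathcal V$. It is monoidal with tensor product $(M\bullet N)_{x,y}=M_{x,y}\otimes N_{x,y}$ and unit object $J$, $J_{x,y}=k$ for all $x,y\in X$. A $\mathcal V$-category $A$ with underlying class $X$ is an object $A\in\mathcal V(X)$ with morphisms $m_{x,y,z}:A_{x,y}\otimes A_{y,z}\to A_{x,z}$ and $\eta_x:k\to A_{x,x}$ satisfying $m_{x,y,t}\circ(\mathrm{id}\otimes m_{y,z,t})=m_{x,z,t}\circ(m_{x,y,z}\otimes\mathrm{id})$ and $m_{x,x,y}\circ(\eta_x\otimes\mathrm{id})=\mathrm{id}=m_{x,y,y}\circ(\mathrm{id}\otimes\eta_y)$. $\mathcal C(\mathcal V)$ is the monoidal category of coalgebras in $\mathcal V$ (tensor product coalgebra formed with the braiding $c$). A $\mathcal C(\mathcal V)$-category is a $\mathcal V$-category in which each $A_{x,y}$ is a coalgebra $(A_{x,y},\Delta_{x,y},\varepsilon_{x,y})$ in $\mathcal V$ and all $m_{x,y,z}$, $\eta_x$ are coalgebra morphisms. A left $A$-module is an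 object $M\in\mathcal V(X)$ with morphisms $\psi_{x,y,z}:A_{x,y}\otimes M_{y,z}\to M_{x,z}$ in $\mathcal V$ such that $\psi_{x,y,u}\circ(\mathrm{id}\otimes\psi_{y,z,u})=\psi_{x,z,u}\circ(m_{x,y,z}\otimes\mathrm{id})$ and $\psi_{x,x,y}\circ(\eta_x\otimes\mathrm{id})=\mathrm{id}_{M_{x,y}}$. A morphism $\varphi:M\to N$ of left $A$-modules is a morphism in $\mathcal V(X)$ with $\varphi_{x,z}\circ\psi_{x,y,z}=\psi_{x,y,z}\circ(\mathrm{id}\otimes\varphi_{y,z})$ for all $x,y,z\in X$. These form the category ${}_A\mathcal V(X)$. *)

theory Defs
  imports "HOL-Library.FuncSet"
begin

section \<open>Categories and functors\<close>

record ('o, 'm) category =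
  Obj :: "'o set"
  Arr :: "'m set"
  Dom :: "'m \<Rightarrow> 'o"
  Cod :: "'m \<Rightarrow> 'o"
  Id :: "'o \<Rightarrow> 'm" ("\<one>\<index>")
  Comp :: "'m \<Rightarrow> 'm \<Rightarrow> 'm" (infixl "\<cdot>\<index>" 55)

definition Hom :: "('o, 'm, 'z) category_scheme \<Rightarrow> 'o \<Rightarrow> 'o \<Rightarrow> 'm set" where
  "Hom C a b = {f \<in> Arr C. Dom C f = a \<and> Cod C f = b}"

locale category =
  fixes C :: "('o, 'm, 'z) category_scheme" (structure)
  assumes Dom_in_Obj: "f \<in> Arr C \<Longrightarrow> Dom C f \<in> Obj C"
    and Cod_in_Obj: "f \<in> Arr C \<Longrightarrow> Cod C f \<in> Obj C"
    and Id_in_Hom: "a \<in> Obj C \<Longrightarrow> \<one> a \<in> Hom C a a"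
    and Comp_in_Hom: "\<lbrakk>f \<in> Hom C a b; g \<in> Hom C b c\<rbrakk> \<Longrightarrow> g \<cdot> f \<in> Hom C a c"
    and Comp_Id: "f \<in> Hom C a b \<Longrightarrow> f \<cdot> \<one> a = f"
    and Id_Comp: "f \<in> Hom C a b \<Longrightarrow> \<one> b \<cdot> f = f"
    and Comp_assoc:
      "\<lbrakk>f \<in> Hom C a b; g \<in> Hom C b c; h \<in> Hom C c d\<rbrakk> \<Longrightarrow> (h \<cdot> g) \<cdot> f = h \<cdot> (g \<cdot> f)"

definition iso_arr :: "('o, 'm, 'z) category_scheme \<Rightarrow> 'm \<Rightarrow> bool" where
  "iso_arr C f \<longleftrightarrow> f \<in> Arr C \<and>
     (\<exists>g \<in> Hom C (Cod C f) (Dom C f).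
        g \<cdot>\<^bsub>C\<^esub> f = \<one>\<^bsub>C\<^esub> (Dom C f) \<and> f \<cdot>\<^bsub>C\<^esub> g = \<one>\<^bsub>C\<^esub> (Cod C f))"

locale cat_functor = source: category C + target: category D
  for C :: "('o, 'm, 'z) category_scheme" and D :: "('p, 'n, 'y) category_scheme" +
  fixes FO :: "'o \<Rightarrow> 'p" and FA :: "'m \<Rightarrow> 'n"
  assumes FO_in_Obj: "a \<in> Obj C \<Longrightarrow> FO a \<in> Obj D"
    and FA_in_Hom: "f \<in> Hom C a b \<Longrightarrow> FA f \<in> Hom D (FO a) (FO b)"
    and FA_Id: "a \<in> Obj C \<Longrightarrow> FA (\<one>\<^bsub>C\<^esub> a) = \<one>\<^bsub>D\<^esub> (FO a)"
    and FA_Comp: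
      "\<lbrakk>f \<in> Hom C a b; g \<in> Hom C b c\<rbrakk> \<Longrightarrow> FA (g \<cdot>\<^bsub>C\<^esub> f) = FA g \<cdot>\<^bsub>D\<^esub> FA f"


section \<open>Monoidal categories and monoidal functors\<close>

record ('o, 'm) monoidal_category = "('o, 'm) category" +
  tensO :: "'o \<Rightarrow> 'o \<Rightarrow> 'o" (infixl "\<otimes>\<^sub>o\<index>" 70)
  tensA :: "'m \<Rightarrow> 'm \<Rightarrow> 'm" (infixl "\<otimes>\<index>" 70)
  unitO :: "'o" ("\<k>\<index>")
  assoc :: "'o \<Rightarrow> 'o \<Rightarrow> 'o \<Rightarrow> 'm"
  lunit :: "'o \<Rightarrow> 'm"
  runit :: "'o \<Rightarrow> 'm"

locale monoidal_category = category C
  for C :: "('o, 'm, 'z) monoidal_category_scheme" (structure) +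
  assumes tensO_in_Obj: "\<lbrakk>a \<in> Obj C; b \<in> Obj C\<rbrakk> \<Longrightarrow> a \<otimes>\<^sub>o b \<in> Obj C"
    and tensA_in_Hom:
      "\<lbrakk>f \<in> Hom C a b; g \<in> Hom C a' b'\<rbrakk> \<Longrightarrow> f \<otimes> g \<in> Hom C (a \<otimes>\<^sub>o a') (b \<otimes>\<^sub>o b')"
    and tensA_Id: "\<lbrakk>a \<in> Obj C; b \<in> Obj C\<rbrakk> \<Longrightarrow> \<one> a \<otimes> \<one> b = \<one> (a \<otimes>\<^sub>o b)"
    and tensA_Comp:
      "\<lbrakk>f \<in> Hom C a b; g \<in> Hom C b c; f' \<in> Hom C a' b'; g' \<in> Hom C b' c'\<rbrakk>
       \<Longrightarrow> (g \<cdot> f) \<otimes> (g' \<cdot> f') = (g \<otimes> g') \<cdot> (f \<otimes> f')"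
    and unitO_in_Obj: "\<k> \<in> Obj C"
    and assoc_in_Hom:
      "\<lbrakk>a \<in> Obj C; b \<in> Obj C; c \<in> Obj C\<rbrakk>
       \<Longrightarrow> assoc C a b c \<in> Hom C ((a \<otimes>\<^sub>o b) \<otimes>\<^sub>o c) (a \<otimes>\<^sub>o (b \<otimes>\<^sub>o c))"
    and assoc_iso:
      "\<lbrakk>a \<in> Obj C; b \<in> Obj C; c \<in> Obj C\<rbrakk> \<Longrightarrow> iso_arr C (assoc C a b c)"
    and assoc_natural:
      "\<lbrakk>f \<in> Hom C a a'; g \<in> Hom C b b'; h \<in> Hom C c c'\<rbrakk>
       \<Longrightarrow> assoc C a' b' c' \<cdot> ((f \<otimes> g) \<otimes> h) = (f \<otimes> (g \<otimes> h)) \<cdot> assoc C a b c"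
    and lunit_in_Hom: "a \<in> Obj C \<Longrightarrow> lunit C a \<in> Hom C (\<k> \<otimes>\<^sub>o a) a"
    and lunit_iso: "a \<in> Obj C \<Longrightarrow> iso_arr C (lunit C a)"
    and lunit_natural: "f \<in> Hom C a b \<Longrightarrow> lunit C b \<cdot> (\<one> \<k> \<otimes> f) = f \<cdot> lunit C a"
    and runit_in_Hom: "a \<in> Obj C \<Longrightarrow> runit C a \<in> Hom C (a \<otimes>\<^sub>o \<k>) a"
    and runit_iso: "a \<in> Obj C \<Longrightarrow> iso_arr C (runit C a)"
    and runit_natural: "f \<in> Hom C a b \<Longrightarrow> runit C b \<cdot> (f \<otimes> \<one> \<k>) = f \<cdot> runit C a"
    and pentagon:
      "\<lbrakk>a \<in> Obj C; b \<in> Obj C; c \<in> Obj C; d \<in> Obj C\<rbrakk>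
       \<Longrightarrow> assoc C a b (c \<otimes>\<^sub>o d) \<cdot> assoc C (a \<otimes>\<^sub>o b) c d
         = (\<one> a \<otimes> assoc C b c d) \<cdot> (assoc C a (b \<otimes>\<^sub>o c) d \<cdot> (assoc C a b c \<otimes> \<one> d))"
    and triangle:
      "\<lbrakk>a \<in> Obj C; b \<in> Obj C\<rbrakk>
       \<Longrightarrow> (\<one> a \<otimes> lunit C b) \<cdot> assoc C a \<k> b = runit C a \<otimes> \<one> b"

text \<open>
  Monoidal functors are understood in the strong sense: the comparison arrows
  \<open>F2 a b : F a \<otimes> F b \<rightarrow> F (a \<otimes> b)\<close> and \<open>F0 : k \<rightarrow> F k\<close> are invertible.
\<close>

locale strong_monoidal_functor =
  source: monoidal_category C + target: monoidal_category D + cat_functor C D FO FA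
  for C :: "('o, 'm, 'z) monoidal_category_scheme"
    and D :: "('p, 'n, 'y) monoidal_category_scheme"
    and FO :: "'o \<Rightarrow> 'p" and FA :: "'m \<Rightarrow> 'n" +
  fixes F2 :: "'o \<Rightarrow> 'o \<Rightarrow> 'n" and F0 :: "'n"
  assumes F2_in_Hom:
      "\<lbrakk>a \<in> Obj C; b \<in> Obj C\<rbrakk>
       \<Longrightarrow> F2 a b \<in> Hom D (FO a \<otimes>\<^sub>o\<^bsub>D\<^esub> FO b) (FO (a \<otimes>\<^sub>o\<^bsub>C\<^esub> b))"
    and F2_iso: "\<lbrakk>a \<in> Obj C; b \<in> Obj C\<rbrakk> \<Longrightarrow> iso_arr D (F2 a b)"
    and F2_natural:
      "\<lbrakk>f \<in> Hom C a a'; g \<in> Hom C b b'\<rbrakk>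
       \<Longrightarrow> F2 a' b' \<cdot>\<^bsub>D\<^esub> (FA f \<otimes>\<^bsub>D\<^esub> FA g) = FA (f \<otimes>\<^bsub>C\<^esub> g) \<cdot>\<^bsub>D\<^esub> F2 a b"
    and F0_in_Hom: "F0 \<in> Hom D \<k>\<^bsub>D\<^esub> (FO \<k>\<^bsub>C\<^esub>)"
    and F0_iso: "iso_arr D F0"
    and F2_assoc:
      "\<lbrakk>a \<in> Obj C; b \<in> Obj C; c \<in> Obj C\<rbrakk>
       \<Longrightarrow> FA (assoc C a b c) \<cdot>\<^bsub>D\<^esub>
             (F2 (a \<otimes>\<^sub>o\<^bsub>C\<^esub> b) c \<cdot>\<^bsub>D\<^esub> (F2 a b \<otimes>\<^bsub>D\<^esub> \<one>\<^bsub>D\<^esub> (FO c)))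
         = F2 a (b \<otimes>\<^sub>o\<^bsub>C\<^esub> c) \<cdot>\<^bsub>D\<^esub>
             ((\<one>\<^bsub>D\<^esub> (FO a) \<otimes>\<^bsub>D\<^esub> F2 b c) \<cdot>\<^bsub>D\<^esub> assoc D (FO a) (FO b) (FO c))"
    and F2_lunit:
      "a \<in> Obj C
       \<Longrightarrow> FA (lunit C a) \<cdot>\<^bsub>D\<^esub> (F2 \<k>\<^bsub>C\<^esub> a \<cdot>\<^bsub>D\<^esub> (F0 \<otimes>\<^bsub>D\<^esub> \<one>\<^bsub>D\<^esub> (FO a))) = lunit D (FO a)"
    and F2_runit:
      "a \<in> Obj C
       \<Longrightarrow> FA (runit C a) \<cdot>\<^bsub>D\<^esub> (F2 a \<k>\<^bsub>C\<^esub> \<cdot>\<^bsub>D\<^esub> (\<one>\<^bsub>D\<^esub> (FO a) \<otimes>\<^bsub>D\<^esub> F0)) = runit D (FO a)"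

record ('o, 'm) braided_category = "('o, 'm) monoidal_category" +
  braid :: "'o \<Rightarrow> 'o \<Rightarrow> 'm"

text \<open>
  In the strict case the associators disappear from the two hexagon axioms.
\<close>

locale strict_braided_monoidal_category = monoidal_category V
  for V :: "('o, 'm, 'z) braided_category_scheme" (structure) +
  assumes strict_assocO:
      "\<lbrakk>a \<in> Obj V; b \<in> Obj V; c \<in> Obj V\<rbrakk>
       \<Longrightarrow> (a \<otimes>\<^sub>o b) \<otimes>\<^sub>o c = a \<otimes>\<^sub>o (b \<otimes>\<^sub>o c)"
    and strict_lunitO: "a \<in> Obj V \<Longrightarrow> \<k> \<otimes>\<^sub>o a = a"
    and strict_runitO: "a \<in> Obj V \<Longrightarrow> a \<otimes>\<^sub>o \<k> = a"
    and strict_assoc: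
      "\<lbrakk>a \<in> Obj V; b \<in> Obj V; c \<in> Obj V\<rbrakk> \<Longrightarrow> assoc V a b c = \<one> (a \<otimes>\<^sub>o b \<otimes>\<^sub>o c)"
    and strict_lunit: "a \<in> Obj V \<Longrightarrow> lunit V a = \<one> a"
    and strict_runit: "a \<in> Obj V \<Longrightarrow> runit V a = \<one> a"
    and braid_in_Hom:
      "\<lbrakk>a \<in> Obj V; b \<in> Obj V\<rbrakk> \<Longrightarrow> braid V a b \<in> Hom V (a \<otimes>\<^sub>o b) (b \<otimes>\<^sub>o a)"
    and braid_iso: "\<lbrakk>a \<in> Obj V; b \<in> Obj V\<rbrakk> \<Longrightarrow> iso_arr V (braid V a b)"
    and braid_natural:
      "\<lbrakk>f \<in> Hom V a a'; g \<in> Hom V b b'\<rbrakk>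
       \<Longrightarrow> braid V a' b' \<cdot> (f \<otimes> g) = (g \<otimes> f) \<cdot> braid V a b"
    and hexagon_right:
      "\<lbrakk>a \<in> Obj V; b \<in> Obj V; c \<in> Obj V\<rbrakk>
       \<Longrightarrow> braid V a (b \<otimes>\<^sub>o c) = (\<one> b \<otimes> braid V a c) \<cdot> (braid V a b \<otimes> \<one> c)"
    and hexagon_left:
      "\<lbrakk>a \<in> Obj V; b \<in> Obj V; c \<in> Obj V\<rbrakk>
       \<Longrightarrow> braid V (a \<otimes>\<^sub>o b) c = (braid V a c \<otimes> \<one> b) \<cdot> (\<one> a \<otimes> braid V b c)"


section \<open>Coalgebras in a strict braided monoidal category\<close>

record ('o, 'm) coalg =
  cob :: 'o
  comult :: 'm
  counit :: 'm

locale coalgebra =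
  fixes V :: "('o, 'm, 'z) monoidal_category_scheme" (structure)
    and C :: "('o, 'm) coalg"
  assumes cob_in_Obj: "cob C \<in> Obj V"
    and comult_in_Hom: "comult C \<in> Hom V (cob C) (cob C \<otimes>\<^sub>o cob C)"
    and counit_in_Hom: "counit C \<in> Hom V (cob C) \<k>"
    and coassociative:
      "(comult C \<otimes> \<one> (cob C)) \<cdot> comult C = (\<one> (cob C) \<otimes> comult C) \<cdot> comult C"
    and counit_left: "(counit C \<otimes> \<one> (cob C)) \<cdot> comult C = \<one> (cob C)"
    and counit_right: "(\<one> (cob C) \<otimes> counit C) \<cdot> comult C = \<one> (cob C)"

definition tensor_coalg ::
  "('o, 'm, 'z) braided_category_scheme \<Rightarrow> ('o, 'm) coalg \<Rightarrow> ('o, 'm) coalg \<Rightarrow> ('o, 'm) coalg"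
  where
  "tensor_coalg V C D =
     \<lparr>cob = cob C \<otimes>\<^sub>o\<^bsub>V\<^esub> cob D,
      comult = (\<one>\<^bsub>V\<^esub> (cob C) \<otimes>\<^bsub>V\<^esub> braid V (cob C) (cob D) \<otimes>\<^bsub>V\<^esub> \<one>\<^bsub>V\<^esub> (cob D))
               \<cdot>\<^bsub>V\<^esub> (comult C \<otimes>\<^bsub>V\<^esub> comult D),
      counit = counit C \<otimes>\<^bsub>V\<^esub> counit D\<rparr>"

definition unit_coalg :: "('o, 'm, 'z) monoidal_category_scheme \<Rightarrow> ('o, 'm) coalg" where
  "unit_coalg V = \<lparr>cob = \<k>\<^bsub>V\<^esub>, comult = \<one>\<^bsub>V\<^esub> \<k>\<^bsub>V\<^esub>, counit = \<one>\<^bsub>V\<^esub> \<k>\<^bsub>V\<^esub>\<rparr>"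

definition coalg_morphism ::
  "('o, 'm, 'z) monoidal_category_scheme \<Rightarrow> ('o, 'm) coalg \<Rightarrow> ('o, 'm) coalg \<Rightarrow> 'm \<Rightarrow> bool"
  where
  "coalg_morphism V C D f \<longleftrightarrow>
     f \<in> Hom V (cob C) (cob D) \<and>
     comult D \<cdot>\<^bsub>V\<^esub> f = (f \<otimes>\<^bsub>V\<^esub> f) \<cdot>\<^bsub>V\<^esub> comult C \<and>
     counit D \<cdot>\<^bsub>V\<^esub> f = counit C"


section \<open>Families of objects indexed by pairs\<close>

text \<open>
  Families are extensional functions on \<open>X \<times> X\<close>, so that two families are equal
  in HOL iff they agree at every pair of elements of \<open>X\<close>.
\<close>

definition family_category ::
  "('o, 'm, 'z) monoidal_category_scheme \<Rightarrow> 'x set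
   \<Rightarrow> ('x \<times> 'x \<Rightarrow> 'o, 'x \<times> 'x \<Rightarrow> 'm) monoidal_category"
  where
  "family_category V X =
     \<lparr>Obj = X \<times> X \<rightarrow>\<^sub>E Obj V,
      Arr = X \<times> X \<rightarrow>\<^sub>E Arr V,
      Dom = (\<lambda>\<phi>. \<lambda>p\<in>X \<times> X. Dom V (\<phi> p)),
      Cod = (\<lambda>\<phi>. \<lambda>p\<in>X \<times> X. Cod V (\<phi> p)),
      Id = (\<lambda>M. \<lambda>p\<in>X \<times> X. \<one>\<^bsub>V\<^esub> (M p)),
      Comp = (\<lambda>\<psi> \<phi>. \<lambda>p\<in>X \<times> X. \<psi> p \<cdot>\<^bsub>V\<^esub> \<phi> p),
      tensO = (\<lambda>M N. \<lambda>p\<in>X \<times> X. M p \<otimes>\<^sub>o\<^bsub>V\<^esub> N p),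
      tensA = (\<lambda>\<phi> \<psi>. \<lambda>p\<in>X \<times> X. \<phi> p \<otimes>\<^bsub>V\<^esub> \<psi> p),
      unitO = (\<lambda>p\<in>X \<times> X. \<k>\<^bsub>V\<^esub>),
      assoc = (\<lambda>M N P. \<lambda>p\<in>X \<times> X. assoc V (M p) (N p) (P p)),
      lunit = (\<lambda>M. \<lambda>p\<in>X \<times> X. lunit V (M p)),
      runit = (\<lambda>M. \<lambda>p\<in>X \<times> X. runit V (M p))\<rparr>"


section \<open>Enriched categories and their modules\<close>

text \<open>
  The equations below omit the associators and unitors of \<open>V\<close>; they are meant
  for strict \<open>V\<close>.
\<close>

record ('x, 'o, 'm) vcat =
  hob :: "'x \<times> 'x \<Rightarrow> 'o"
  mult :: "'x \<times> 'x \<times> 'x \<Rightarrow> 'm"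
  unit :: "'x \<Rightarrow> 'm"

locale v_category =
  fixes V :: "('o, 'm, 'z) monoidal_category_scheme" (structure)
    and X :: "'x set"
    and A :: "('x, 'o, 'm, 'y) vcat_scheme"
  assumes hob_in_Obj: "hob A \<in> Obj (family_category V X)"
    and mult_in_Hom:
      "\<lbrakk>x \<in> X; y \<in> X; z \<in> X\<rbrakk>
       \<Longrightarrow> mult A (x, y, z) \<in> Hom V (hob A (x, y) \<otimes>\<^sub>o hob A (y, z)) (hob A (x, z))"
    and unit_in_Hom: "x \<in> X \<Longrightarrow> unit A x \<in> Hom V \<k> (hob A (x, x))"
    and mult_assoc:
      "\<lbrakk>x \<in> X; y \<in> X; z \<in> X; t \<in> X\<rbrakk>
       \<Longrightarrow> mult A (x, y, t) \<cdot> (\<one> (hob A (x, y)) \<otimes> mult A (y, z, t))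
         = mult A (x, z, t) \<cdot> (mult A (x, y, z) \<otimes> \<one> (hob A (z, t)))"
    and unit_mult:
      "\<lbrakk>x \<in> X; y \<in> X\<rbrakk>
       \<Longrightarrow> mult A (x, x, y) \<cdot> (unit A x \<otimes> \<one> (hob A (x, y))) = \<one> (hob A (x, y))"
    and mult_unit:
      "\<lbrakk>x \<in> X; y \<in> X\<rbrakk>
       \<Longrightarrow> mult A (x, y, y) \<cdot> (\<one> (hob A (x, y)) \<otimes> unit A y) = \<one> (hob A (x, y))"

record ('x, 'o, 'm) cvcat = "('x, 'o, 'm) vcat" +
  hcomult :: "'x \<times> 'x \<Rightarrow> 'm"
  hcounit :: "'x \<times> 'x \<Rightarrow> 'm"

definition hom_coalg :: "('x, 'o, 'm, 'y) cvcat_scheme \<Rightarrow> 'x \<Rightarrow> 'x \<Rightarrow> ('o, 'm) coalg" where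
  "hom_coalg A x y = \<lparr>cob = hob A (x, y), comult = hcomult A (x, y), counit = hcounit A (x, y)\<rparr>"

locale cv_category = v_category V X A
  for V :: "('o, 'm, 'z) braided_category_scheme" (structure)
    and X :: "'x set"
    and A :: "('x, 'o, 'm, 'y) cvcat_scheme" +
  assumes hom_coalgebra: "\<lbrakk>x \<in> X; y \<in> X\<rbrakk> \<Longrightarrow> coalgebra V (hom_coalg A x y)"
    and mult_coalg_morphism:
      "\<lbrakk>x \<in> X; y \<in> X; z \<in> X\<rbrakk>
       \<Longrightarrow> coalg_morphism V (tensor_coalg V (hom_coalg A x y) (hom_coalg A y z))
             (hom_coalg A x z) (mult A (x, y, z))"
    and unit_coalg_morphism:
      "x \<in> X \<Longrightarrow> coalg_morphism V (unit_coalg V) (hom_coalg A x x) (unit A x)"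

record ('x, 'o, 'm) vmod =
  mob :: "'x \<times> 'x \<Rightarrow> 'o"
  act :: "'x \<times> 'x \<times> 'x \<Rightarrow> 'm"

locale left_module =
  fixes V :: "('o, 'm, 'z) monoidal_category_scheme" (structure)
    and X :: "'x set"
    and A :: "('x, 'o, 'm, 'y) vcat_scheme"
    and M :: "('x, 'o, 'm) vmod"
  assumes mob_in_Obj: "mob M \<in> Obj (family_category V X)"
    and act_extensional: "act M \<in> extensional (X \<times> X \<times> X)"
    and act_in_Hom:
      "\<lbrakk>x \<in> X; y \<in> X; z \<in> X\<rbrakk>
       \<Longrightarrow> act M (x, y, z) \<in> Hom V (hob A (x, y) \<otimes>\<^sub>o mob M (y, z)) (mob M (x, z))"
    and act_assoc:
      "\<lbrakk>x \<in> X; y \<in> X; z \<in> X; u \<in> X\<rbrakk>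
       \<Longrightarrow> act M (x, y, u) \<cdot> (\<one> (hob A (x, y)) \<otimes> act M (y, z, u))
         = act M (x, z, u) \<cdot> (mult A (x, y, z) \<otimes> \<one> (mob M (z, u)))"
    and act_unit:
      "\<lbrakk>x \<in> X; y \<in> X\<rbrakk>
       \<Longrightarrow> act M (x, x, y) \<cdot> (unit A x \<otimes> \<one> (mob M (x, y))) = \<one> (mob M (x, y))"

definition module_morphism ::
  "('o, 'm, 'z) monoidal_category_scheme \<Rightarrow> 'x set \<Rightarrow> ('x, 'o, 'm, 'y) vcat_scheme
   \<Rightarrow> ('x, 'o, 'm) vmod \<Rightarrow> ('x, 'o, 'm) vmod \<Rightarrow> ('x \<times> 'x \<Rightarrow> 'm) \<Rightarrow> bool"
  where
  "module_morphism V X A M N \<phi> \<longleftrightarrow>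
     left_module V X A M \<and> left_module V X A N \<and>
     \<phi> \<in> Hom (family_category V X) (mob M) (mob N) \<and>
     (\<forall>x\<in>X. \<forall>y\<in>X. \<forall>z\<in>X.
        \<phi> (x, z) \<cdot>\<^bsub>V\<^esub> act M (x, y, z) = act N (x, y, z) \<cdot>\<^bsub>V\<^esub> (\<one>\<^bsub>V\<^esub> (hob A (x, y)) \<otimes>\<^bsub>V\<^esub> \<phi> (y, z)))"

text \<open>
  A family of arrows does not determine the actions on its domain and codomain, so
  an arrow of the category of left modules is a triple \<open>(M, \<phi>, N)\<close>.
\<close>

type_synonym ('x, 'o, 'm) vmod_arr =
  "('x, 'o, 'm) vmod \<times> ('x \<times> 'x \<Rightarrow> 'm) \<times> ('x, 'o, 'm) vmod"

definition module_category ::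
  "('o, 'm, 'z) monoidal_category_scheme \<Rightarrow> 'x set \<Rightarrow> ('x, 'o, 'm, 'y) vcat_scheme
   \<Rightarrow> (('x, 'o, 'm) vmod, ('x, 'o, 'm) vmod_arr) category"
  where
  "module_category V X A =
     \<lparr>Obj = {M. left_module V X A M},
      Arr = {(M, \<phi>, N). module_morphism V X A M N \<phi>},
      Dom = (\<lambda>(M, \<phi>, N). M),
      Cod = (\<lambda>(M, \<phi>, N). N),
      Id = (\<lambda>M. (M, \<one>\<^bsub>family_category V X\<^esub> (mob M), M)),
      Comp = (\<lambda>(N', \<psi>, P) (M, \<phi>, N). (M, \<psi> \<cdot>\<^bsub>family_category V X\<^esub> \<phi>, P))\<rparr>"

definition forget_obj :: "('x, 'o, 'm) vmod \<Rightarrow> 'x \<times> 'x \<Rightarrow> 'o" where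
  "forget_obj M = mob M"

definition forget_arr :: "('x, 'o, 'm) vmod_arr \<Rightarrow> 'x \<times> 'x \<Rightarrow> 'm" where
  "forget_arr = (\<lambda>(M, \<phi>, N). \<phi>)"

end

theory Submission
  imports Defs
begin

text \<open>
  A coalgebra \<open>H\<close> and the braiding give \<open>\<sigma> : H \<otimes> (M \<otimes> N) \<rightarrow> (H \<otimes> M) \<otimes> (H \<otimes> N)\<close>, comultiply and
  then move the second copy of \<open>H\<close> past \<open>M\<close>, and the action on \<open>M \<bullet> N\<close> is \<open>(\<psi>\<^sub>M \<otimes> \<psi>\<^sub>N) \<cdot> \<sigma>\<close>
  with \<open>H = A\<^sub>x\<^sub>y\<close>. It is associative because \<open>\<sigma>\<close> is natural in coalgebra morphisms such as the
  composition of \<open>A\<close>, and \<open>\<sigma>\<close> for \<open>H \<otimes> K\<close> is the composite of those for \<open>H\<close> and \<open>K\<close> by the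
  hexagons. The unit family is a module through the counits. Since \<open>V\<close> is strict, coassociativity
  and the counit laws make this tensor product of modules strictly associative and unital, so all
  structure arrows are identities and the forgetful functor is strict monoidal.
\<close>

section \<open>Strict monoidal categories\<close>

lemma HomD:
  assumes "f \<in> Hom C a b"
  shows "f \<in> Arr C" "Dom C f = a" "Cod C f = b"
  using assms by (auto simp: Hom_def)

lemma HomI: "f \<in> Arr C \<Longrightarrow> Dom C f = a \<Longrightarrow> Cod C f = b \<Longrightarrow> f \<in> Hom C a b"
  by (simp add: Hom_def)

context category
begin

text \<open>Typing is restated through \<open>Arr\<close>, \<open>Dom\<close> and
  \<open>Cod\<close>: \<open>Hom\<close> membership mentions intermediate objects that a rewrite
  rule cannot guess, whereas equations between domains and codomains can be computed by the
  simplifier.\<close>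

lemma Id_simps [simp]:
  assumes "a \<in> Obj C"
  shows "\<one> a \<in> Arr C" "Dom C (\<one> a) = a" "Cod C (\<one> a) = a"
  using Id_in_Hom[OF assms] by (auto simp: Hom_def)

lemma Comp_simps [simp]:
  assumes "f \<in> Arr C" "g \<in> Arr C" "Dom C g = Cod C f"
  shows "g \<cdot> f \<in> Arr C" "Dom C (g \<cdot> f) = Dom C f" "Cod C (g \<cdot> f) = Cod C g"
  using Comp_in_Hom[of f "Dom C f" "Cod C f" g "Cod C g"] assms by (auto simp: Hom_def)

lemma Comp_Id_Arr [simp]: "f \<in> Arr C \<Longrightarrow> Dom C f = a \<Longrightarrow> f \<cdot> \<one> a = f"
  using Comp_Id[of f a "Cod C f"] by (auto simp: Hom_def)

lemma Id_Comp_Arr [simp]: "f \<in> Arr C \<Longrightarrow> Cod C f = b \<Longrightarrow> \<one> b \<cdot> f = f"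
  using Id_Comp[of f "Dom C f" b] by (auto simp: Hom_def)

lemma Comp_assoc_Arr:
  "\<lbrakk>f \<in> Arr C; g \<in> Arr C; h \<in> Arr C; Dom C g = Cod C f; Dom C h = Cod C g\<rbrakk>
   \<Longrightarrow> (h \<cdot> g) \<cdot> f = h \<cdot> (g \<cdot> f)"
  using Comp_assoc[of f "Dom C f" "Cod C f" g "Cod C g" h "Cod C h"] by (auto simp: Hom_def)

lemma iso_arr_Id:
  assumes "a \<in> Obj C"
  shows "iso_arr C (\<one> a)"
proof -
  have "\<one> a \<in> Hom C (Cod C (\<one> a)) (Dom C (\<one> a))"
    using assms Id_in_Hom by simp
  then show ?thesis
    using assms by (auto simp: iso_arr_def intro!: bexI[of _ "\<one> a"])
qed

text \<open>Cancelling one factor of \<open>f \<cdot> f = f\<close> with an inverse leaves the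
  identity. This serves to compute the braiding with the unit object.\<close>

lemma idempotent_iso_arr:
  assumes "iso_arr C f" "f \<cdot> f = f" "Dom C f = a" "Cod C f = a"
  shows "f = \<one> a"
proof -
  from assms obtain g where f: "f \<in> Arr C" and g: "g \<in> Hom C a a" "g \<cdot> f = \<one> a"
    by (auto simp: iso_arr_def)
  have "f = (g \<cdot> f) \<cdot> f"
    using f g(2) assms by simp
  also have "\<dots> = g \<cdot> (f \<cdot> f)"
    using f HomD[OF g(1)] assms by (simp add: Comp_assoc_Arr)
  finally show ?thesis
    using g(2) assms(2) by simp
qed

end

context monoidal_category
begin

declare tensO_in_Obj [simp] unitO_in_Obj [simp]

lemma tensA_simps [simp]:
  assumes "f \<in> Arr C" "g \<in> Arr C"
  shows "f \<otimes> g \<in> Arr C" "Dom C (f \<otimes> g) = Dom C f \<otimes>\<^sub>o Dom C g"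
    "Cod C (f \<otimes> g) = Cod C f \<otimes>\<^sub>o Cod C g"
  using tensA_in_Hom[of f "Dom C f" "Cod C f" g "Dom C g" "Cod C g"] assms
  by (auto simp: Hom_def)

text \<open>Functoriality \<open>tensA_Comp\<close> read from right to left: as a rewrite rule it
  merges two composed tensor products factor by factor, provided both are bracketed alike.\<close>

lemma interchange:
  "\<lbrakk>f \<in> Arr C; g \<in> Arr C; f' \<in> Arr C; g' \<in> Arr C; Dom C g = Cod C f; Dom C g' = Cod C f'\<rbrakk>
   \<Longrightarrow> (g \<otimes> g') \<cdot> (f \<otimes> f') = (g \<cdot> f) \<otimes> (g' \<cdot> f')"
  using tensA_Comp[of f "Dom C f" "Cod C f" g "Cod C g" f' "Dom C f'" "Cod C f'" g' "Cod C g'"]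
  by (auto simp: Hom_def)

end

text \<open>When the coherence arrows are identities, their naturality amounts to strict
  associativity and unitality of the tensor product on arrows, and pentagon and triangle compare
  identities. Both the families and the modules are treated with this criterion.\<close>

lemma strict_monoidal_categoryI:
  fixes C :: "('o, 'm, 'z) monoidal_category_scheme" (structure)
  assumes "category C"
    and tensO: "\<And>a b. \<lbrakk>a \<in> Obj C; b \<in> Obj C\<rbrakk> \<Longrightarrow> a \<otimes>\<^sub>o b \<in> Obj C"
    and tensA: "\<And>f g a b a' b'.
      \<lbrakk>f \<in> Hom C a b; g \<in> Hom C a' b'\<rbrakk> \<Longrightarrow> f \<otimes> g \<in> Hom C (a \<otimes>\<^sub>o a') (b \<otimes>\<^sub>o b')"
    and tensA_Id: "\<And>a b. \<lbrakk>a \<in> Obj C; b \<in> Obj C\<rbrakk> \<Longrightarrow> \<one> a \<otimes> \<one> b = \<one> (a \<otimes>\<^sub>o b)"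
    and tensA_Comp: "\<And>f g f' g' a b c a' b' c'.
      \<lbrakk>f \<in> Hom C a b; g \<in> Hom C b c; f' \<in> Hom C a' b'; g' \<in> Hom C b' c'\<rbrakk>
       \<Longrightarrow> (g \<cdot> f) \<otimes> (g' \<cdot> f') = (g \<otimes> g') \<cdot> (f \<otimes> f')"
    and unitO: "\<k> \<in> Obj C"
    and assocO: "\<And>a b c. \<lbrakk>a \<in> Obj C; b \<in> Obj C; c \<in> Obj C\<rbrakk>
       \<Longrightarrow> (a \<otimes>\<^sub>o b) \<otimes>\<^sub>o c = a \<otimes>\<^sub>o (b \<otimes>\<^sub>o c)"
    and lunitO: "\<And>a. a \<in> Obj C \<Longrightarrow> \<k> \<otimes>\<^sub>o a = a"
    and runitO: "\<And>a. a \<in> Obj C \<Longrightarrow> a \<otimes>\<^sub>o \<k> = a"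
    and assocA: "\<And>f g h. \<lbrakk>f \<in> Arr C; g \<in> Arr C; h \<in> Arr C\<rbrakk>
       \<Longrightarrow> (f \<otimes> g) \<otimes> h = f \<otimes> (g \<otimes> h)"
    and lunitA: "\<And>f. f \<in> Arr C \<Longrightarrow> \<one> \<k> \<otimes> f = f"
    and runitA: "\<And>f. f \<in> Arr C \<Longrightarrow> f \<otimes> \<one> \<k> = f"
    and assoc: "\<And>a b c. \<lbrakk>a \<in> Obj C; b \<in> Obj C; c \<in> Obj C\<rbrakk>
       \<Longrightarrow> assoc C a b c = \<one> (a \<otimes>\<^sub>o b \<otimes>\<^sub>o c)"
    and lunit: "\<And>a. a \<in> Obj C \<Longrightarrow> lunit C a = \<one> a"
    and runit: "\<And>a. a \<in> Obj C \<Longrightarrow> runit C a = \<one> a"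
  shows "monoidal_category C"
proof -
  interpret category C by fact
  note [simp] = tensO unitO assocO lunitO runitO assocA lunitA runitA assoc lunit runit
  have obj: "a \<in> Obj C" "b \<in> Obj C" if "f \<in> Hom C a b" for f a b
    using that Dom_in_Obj Cod_in_Obj by (auto simp: Hom_def)
  show ?thesis
  proof (unfold_locales)
    show "assoc C a' b' c' \<cdot> (f \<otimes> g \<otimes> h) = f \<otimes> (g \<otimes> h) \<cdot> assoc C a b c"
      if "f \<in> Hom C a a'" "g \<in> Hom C b b'" "h \<in> Hom C c c'" for f g h a a' b b' c c'
    proof -
      \<comment> \<open>Once the associators are identities, both sides reduce to this arrow as soon
        as its domain and codomain are known.\<close>
      have "f \<otimes> (g \<otimes> h) \<in> Hom C (a \<otimes>\<^sub>o (b \<otimes>\<^sub>o c)) (a' \<otimes>\<^sub>o (b' \<otimes>\<^sub>o c'))"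
        using that by (intro tensA)
      then show ?thesis
        using that[THEN HomD(1)] obj[OF that(1)] obj[OF that(2)] obj[OF that(3)]
        by (simp add: Hom_def)
    qed
    show "lunit C b \<cdot> (\<one> \<k> \<otimes> f) = f \<cdot> lunit C a"
      "runit C b \<cdot> (f \<otimes> \<one> \<k>) = f \<cdot> runit C a" if "f \<in> Hom C a b" for f a b
      using obj[OF that] HomD[OF that] by simp_all
  qed (use obj in \<open>auto simp: Comp_Id Id_Comp tensA tensA_Id tensA_Comp Id_in_Hom iso_arr_Id dest: HomD\<close>)
qed

section \<open>Strictness on arrows and the braiding with the unit object\<close>

context strict_braided_monoidal_category
begin

declare strict_assocO [simp] strict_lunitO [simp] strict_runitO [simp]
  Dom_in_Obj [simp] Cod_in_Obj [simp]

text \<open>This is naturality of an associator that is an identity. As a simp rule it nests tensor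
  products to the right; it is switched off wherever \<open>interchange\<close> has to see another
  bracketing.\<close>

lemma tensA_assoc [simp]:
  assumes "f \<in> Arr V" "g \<in> Arr V" "h \<in> Arr V"
  shows "(f \<otimes> g) \<otimes> h = f \<otimes> (g \<otimes> h)"
  using assoc_natural[of f "Dom V f" "Cod V f" g "Dom V g" "Cod V g" h "Dom V h" "Cod V h"] assms
  by (simp add: Hom_def strict_assoc)

lemma unit_tensA [simp]: "f \<in> Arr V \<Longrightarrow> \<one> \<k> \<otimes> f = f"
  using lunit_natural[of f "Dom V f" "Cod V f"] by (simp add: Hom_def strict_lunit)

lemma tensA_unit [simp]: "f \<in> Arr V \<Longrightarrow> f \<otimes> \<one> \<k> = f"
  using runit_natural[of f "Dom V f" "Cod V f"] by (simp add: Hom_def strict_runit)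

lemma braid_simps [simp]:
  assumes "a \<in> Obj V" "b \<in> Obj V"
  shows "braid V a b \<in> Arr V" "Dom V (braid V a b) = a \<otimes>\<^sub>o b" "Cod V (braid V a b) = b \<otimes>\<^sub>o a"
  using braid_in_Hom[OF assms] by (auto simp: Hom_def)

lemma braid_natural_Arr:
  "\<lbrakk>f \<in> Arr V; g \<in> Arr V; Dom V f = a; Cod V f = a'; Dom V g = b; Cod V g = b'\<rbrakk>
   \<Longrightarrow> braid V a' b' \<cdot> (f \<otimes> g) = (g \<otimes> f) \<cdot> braid V a b"
  using braid_natural[of f a a' g b b'] by (simp add: Hom_def)

text \<open>The left hexagon at two unit objects makes this braiding idempotent, and an invertible
  idempotent is an identity.\<close>

lemma braid_unit_left [simp]:
  assumes "a \<in> Obj V" shows "braid V \<k> a = \<one> a"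
  using hexagon_left[of \<k> \<k> a] assms
  by (intro idempotent_iso_arr) (auto simp: braid_iso)

lemma braid_unit_right [simp]:
  assumes "a \<in> Obj V" shows "braid V a \<k> = \<one> a"
  using hexagon_right[of a \<k> \<k>] assms
  by (intro idempotent_iso_arr) (auto simp: braid_iso)

end

lemma (in coalgebra) coalgebra_simps:
  "cob C \<in> Obj V"
  "comult C \<in> Arr V" "Dom V (comult C) = cob C" "Cod V (comult C) = cob C \<otimes>\<^sub>o cob C"
  "comult C \<in> Hom V (cob C) (cob C \<otimes>\<^sub>o cob C)"
  "counit C \<in> Arr V" "Dom V (counit C) = cob C" "Cod V (counit C) = \<k>"
  using cob_in_Obj comult_in_Hom counit_in_Hom by (auto simp: Hom_def)

section \<open>Distributing a coalgebra over a tensor product\<close>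

text \<open>This is the arrow \<open>\<sigma>\<close> for \<open>H = cob C\<close>. It is nested to
  the right, and the identity on the product of \<open>M\<close> and \<open>N\<close> is split into
  two tensor factors, so that later proofs can regroup single factors.\<close>

definition coalg_distrib ::
  "('o, 'm, 'z) braided_category_scheme \<Rightarrow> ('o, 'm) coalg \<Rightarrow> 'o \<Rightarrow> 'o \<Rightarrow> 'm" where
  "coalg_distrib V C M N =
     (\<one>\<^bsub>V\<^esub> (cob C) \<otimes>\<^bsub>V\<^esub> (braid V (cob C) M \<otimes>\<^bsub>V\<^esub> \<one>\<^bsub>V\<^esub> N))
     \<cdot>\<^bsub>V\<^esub> (comult C \<otimes>\<^bsub>V\<^esub> (\<one>\<^bsub>V\<^esub> M \<otimes>\<^bsub>V\<^esub> \<one>\<^bsub>V\<^esub> N))"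

context strict_braided_monoidal_category
begin

text \<open>The premises ask for the typing of the comultiplication rather than for a coalgebra, so
  that the rules apply to \<open>tensor_coalg\<close> as soon as its comultiplication is
  typed.\<close>

lemma coalg_distrib_simps [simp]:
  assumes "cob C \<in> Obj V" "comult C \<in> Hom V (cob C) (cob C \<otimes>\<^sub>o cob C)"
    "M \<in> Obj V" "N \<in> Obj V"
  shows "coalg_distrib V C M N \<in> Arr V"
    "Dom V (coalg_distrib V C M N) = cob C \<otimes>\<^sub>o (M \<otimes>\<^sub>o N)"
    "Cod V (coalg_distrib V C M N) = cob C \<otimes>\<^sub>o (M \<otimes>\<^sub>o (cob C \<otimes>\<^sub>o N))"
  using assms(1,3,4) HomD[OF assms(2)]
  by (simp_all add: coalg_distrib_def)

text \<open>Only \<open>f\<close> is crossed by a copy of \<open>cob C\<close>, so naturality of the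
  braiding in its second argument suffices. The result pulls inner actions, and later module
  morphisms, through \<open>\<sigma>\<close>.\<close>

lemma coalg_distrib_natural:
  assumes C: "coalgebra V C" and f: "f \<in> Hom V M M'" and g: "g \<in> Hom V N N'"
  shows "coalg_distrib V C M' N' \<cdot> (\<one> (cob C) \<otimes> (f \<otimes> g))
       = (\<one> (cob C) \<otimes> (f \<otimes> (\<one> (cob C) \<otimes> g))) \<cdot> coalg_distrib V C M N"
proof -
  let ?H = "cob C"
  note [simp] = coalgebra.coalgebra_simps[OF C] HomD[OF f] HomD[OF g]
  have [simp]: "M \<in> Obj V" "M' \<in> Obj V" "N \<in> Obj V" "N' \<in> Obj V"
    using Dom_in_Obj[of f] Cod_in_Obj[of f] Dom_in_Obj[of g] Cod_in_Obj[of g] by simp_all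
  have "coalg_distrib V C M' N' \<cdot> (\<one> ?H \<otimes> (f \<otimes> g))
      = (\<one> ?H \<otimes> (braid V ?H M' \<otimes> \<one> N')) \<cdot> (comult C \<otimes> (f \<otimes> g))"
    by (simp add: coalg_distrib_def Comp_assoc_Arr interchange)
  \<comment> \<open>The bracketing puts \<open>f\<close> next to the copy of \<open>?H\<close> that
    will be braided past it. The proof first groups the two identities on \<open>?H\<close> over the
    codomain of \<open>comult C\<close>, where they can be absorbed.\<close>
  also have "comult C \<otimes> (f \<otimes> g) = (\<one> ?H \<otimes> ((\<one> ?H \<otimes> f) \<otimes> g)) \<cdot> (comult C \<otimes> (\<one> M \<otimes> \<one> N))"
  proof -
    have "(\<one> ?H \<otimes> ((\<one> ?H \<otimes> f) \<otimes> g)) \<cdot> (comult C \<otimes> (\<one> M \<otimes> \<one> N))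
        = ((\<one> ?H \<otimes> \<one> ?H) \<otimes> (f \<otimes> g)) \<cdot> (comult C \<otimes> (\<one> M \<otimes> \<one> N))"
      by simp
    also have "\<dots> = comult C \<otimes> (f \<otimes> g)"
      by (simp add: interchange tensA_Id del: tensA_assoc)
    finally show ?thesis by simp
  qed
  also have "(\<one> ?H \<otimes> (braid V ?H M' \<otimes> \<one> N')) \<cdot> \<dots>
      = (\<one> ?H \<otimes> ((braid V ?H M' \<cdot> (\<one> ?H \<otimes> f)) \<otimes> g)) \<cdot> (comult C \<otimes> (\<one> M \<otimes> \<one> N))"
    by (simp add: Comp_assoc_Arr[symmetric] interchange del: tensA_assoc)
  also have "braid V ?H M' \<cdot> (\<one> ?H \<otimes> f) = (f \<otimes> \<one> ?H) \<cdot> braid V ?H M"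
    by (rule braid_natural_Arr) simp_all
  also have "\<one> ?H \<otimes> (((f \<otimes> \<one> ?H) \<cdot> braid V ?H M) \<otimes> g)
      = (\<one> ?H \<otimes> ((f \<otimes> \<one> ?H) \<otimes> g)) \<cdot> (\<one> ?H \<otimes> (braid V ?H M \<otimes> \<one> N))"
    by (simp add: interchange del: tensA_assoc)
  finally show ?thesis
    by (simp add: coalg_distrib_def Comp_assoc_Arr)
qed

text \<open>A coalgebra morphism is duplicated by the comultiplication, and naturality of the
  braiding in its first argument carries the second copy past \<open>M\<close>. The instances needed
  are the composition and the units of \<open>A\<close>.\<close>

lemma coalg_distrib_morphism:
  assumes C [simp]: "cob C \<in> Obj V" and \<Delta>: "comult C \<in> Hom V (cob C) (cob C \<otimes>\<^sub>o cob C)"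
    and D: "coalgebra V D"
    and m: "coalg_morphism V C D f"
    and [simp]: "M \<in> Obj V" "N \<in> Obj V"
  shows "coalg_distrib V D M N \<cdot> (f \<otimes> (\<one> M \<otimes> \<one> N))
       = (f \<otimes> (\<one> M \<otimes> (f \<otimes> \<one> N))) \<cdot> coalg_distrib V C M N"
proof -
  let ?H = "cob C" and ?K = "cob D"
  note [simp] = \<Delta> HomD[OF \<Delta>] coalgebra.coalgebra_simps[OF D]
  have f [simp]: "f \<in> Arr V" "Dom V f = ?H" "Cod V f = ?K"
    and c: "comult D \<cdot> f = (f \<otimes> f) \<cdot> comult C"
    using m by (auto simp: coalg_morphism_def Hom_def)
  have "coalg_distrib V D M N \<cdot> (f \<otimes> (\<one> M \<otimes> \<one> N))
      = (\<one> ?K \<otimes> (braid V ?K M \<otimes> \<one> N)) \<cdot> (((f \<otimes> f) \<cdot> comult C) \<otimes> (\<one> M \<otimes> \<one> N))"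
    by (simp add: coalg_distrib_def Comp_assoc_Arr interchange c)
  also have "((f \<otimes> f) \<cdot> comult C) \<otimes> (\<one> M \<otimes> \<one> N)
      = ((f \<otimes> f) \<otimes> (\<one> M \<otimes> \<one> N)) \<cdot> (comult C \<otimes> (\<one> M \<otimes> \<one> N))"
    by (simp add: interchange del: tensA_assoc)
  \<comment> \<open>Regrouping places the second \<open>f\<close> beside \<open>\<one> M\<close>,
    where the braiding acts.\<close>
  also have "\<dots> = (f \<otimes> ((f \<otimes> \<one> M) \<otimes> \<one> N)) \<cdot> (comult C \<otimes> (\<one> M \<otimes> \<one> N))"
    by simp
  also have "(\<one> ?K \<otimes> (braid V ?K M \<otimes> \<one> N)) \<cdot> \<dots>
      = (f \<otimes> ((braid V ?K M \<cdot> (f \<otimes> \<one> M)) \<otimes> \<one> N)) \<cdot> (comult C \<otimes> (\<one> M \<otimes> \<one> N))"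
    by (simp add: Comp_assoc_Arr[symmetric] interchange del: tensA_assoc)
  also have "braid V ?K M \<cdot> (f \<otimes> \<one> M) = (\<one> M \<otimes> f) \<cdot> braid V ?H M"
    by (rule braid_natural_Arr) simp_all
  also have "f \<otimes> (((\<one> M \<otimes> f) \<cdot> braid V ?H M) \<otimes> \<one> N)
      = (f \<otimes> ((\<one> M \<otimes> f) \<otimes> \<one> N)) \<cdot> (\<one> ?H \<otimes> (braid V ?H M \<otimes> \<one> N))"
    by (simp add: interchange del: tensA_assoc)
  finally show ?thesis
    by (simp add: coalg_distrib_def Comp_assoc_Arr)
qed

text \<open>Both the comultiplication of the unit coalgebra and the braiding with
  \<open>\<k>\<close> are identities. Combined with \<open>coalg_distrib_morphism\<close>, this
  yields the unit law of the tensor product of modules.\<close>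

lemma coalg_distrib_unit:
  assumes [simp]: "M \<in> Obj V" "N \<in> Obj V"
  shows "coalg_distrib V (unit_coalg V) M N = \<one> (M \<otimes>\<^sub>o N)"
  by (simp add: coalg_distrib_def unit_coalg_def tensA_Id)

lemma comult_tensor_coalg_in_Hom:
  assumes C: "coalgebra V C" and D: "coalgebra V D"
  shows "comult (tensor_coalg V C D)
    \<in> Hom V (cob C \<otimes>\<^sub>o cob D) (cob C \<otimes>\<^sub>o cob D \<otimes>\<^sub>o (cob C \<otimes>\<^sub>o cob D))"
  using coalgebra.coalgebra_simps[OF C] coalgebra.coalgebra_simps[OF D]
  by (simp add: tensor_coalg_def Hom_def)

text \<open>Both sides perform the same crossings of \<open>H\<close>, \<open>K\<close> and
  \<open>M\<close> in a different order. The left hexagon splits the crossing of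
  \<open>H \<otimes> K\<close> with \<open>M\<close>, disjoint operations are interchanged, and the
  right hexagon joins the crossings of \<open>H\<close> with \<open>K\<close> and
  \<open>M\<close>.\<close>

lemma coalg_distrib_tensor:
  assumes C: "coalgebra V C" and D: "coalgebra V D"
    and [simp]: "M \<in> Obj V" "N \<in> Obj V"
  shows "coalg_distrib V (tensor_coalg V C D) M N
       = coalg_distrib V C (cob D \<otimes>\<^sub>o M) (cob D \<otimes>\<^sub>o N)
         \<cdot> (\<one> (cob C) \<otimes> coalg_distrib V D M N)"
proof -
  let ?H = "cob C" and ?K = "cob D"
  note [simp] = coalgebra.coalgebra_simps[OF C] coalgebra.coalgebra_simps[OF D]
  note ids = tensA_Id[symmetric]
  let ?cHM = "braid V ?H M" and ?cHK = "braid V ?H ?K" and ?cKM = "braid V ?K M"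
  \<comment> \<open>\<open>?E\<close> comultiplies, giving the order H H K K M N. Then
    \<open>?T\<close> moves the second K past M, \<open>?S\<close> the second H past the first K,
    and \<open>?B\<close> that H past M.\<close>
  let ?B = "\<one> ?H \<otimes> (\<one> ?K \<otimes> (?cHM \<otimes> (\<one> ?K \<otimes> \<one> N)))"
  let ?S = "\<one> ?H \<otimes> (?cHK \<otimes> ((\<one> M \<otimes> \<one> ?K) \<otimes> \<one> N))"
  let ?T = "\<one> ?H \<otimes> (\<one> ?H \<otimes> (\<one> ?K \<otimes> (?cKM \<otimes> \<one> N)))"
  let ?E = "comult C \<otimes> (comult D \<otimes> (\<one> M \<otimes> \<one> N))"
  have "coalg_distrib V (tensor_coalg V C D) M N
      = ?B \<cdot> ((\<one> ?H \<otimes> ((\<one> ?K \<otimes> \<one> ?H) \<otimes> (?cKM \<otimes> \<one> N)))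
          \<cdot> ((\<one> ?H \<otimes> (?cHK \<otimes> ((\<one> ?K \<otimes> \<one> M) \<otimes> \<one> N))) \<cdot> ?E))"
  proof -
    have 1: "\<one> (?H \<otimes>\<^sub>o ?K) \<otimes> (braid V (?H \<otimes>\<^sub>o ?K) M \<otimes> \<one> N)
        = ?B \<cdot> (\<one> ?H \<otimes> ((\<one> ?K \<otimes> \<one> ?H) \<otimes> (?cKM \<otimes> \<one> N)))"
    proof -
      have "\<one> (?H \<otimes>\<^sub>o ?K) \<otimes> (braid V (?H \<otimes>\<^sub>o ?K) M \<otimes> \<one> N)
          = (\<one> ?H \<otimes> \<one> ?K) \<otimes> (((?cHM \<otimes> \<one> ?K) \<cdot> (\<one> ?H \<otimes> ?cKM)) \<otimes> \<one> N)"
        by (simp add: hexagon_left ids)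
      also have "\<dots> = \<one> ?H \<otimes> (\<one> ?K \<otimes> (((?cHM \<otimes> \<one> ?K) \<cdot> (\<one> ?H \<otimes> ?cKM)) \<otimes> \<one> N))"
        by simp
      also have "\<dots> = (\<one> ?H \<otimes> (\<one> ?K \<otimes> ((?cHM \<otimes> \<one> ?K) \<otimes> \<one> N)))
          \<cdot> (\<one> ?H \<otimes> (\<one> ?K \<otimes> ((\<one> ?H \<otimes> ?cKM) \<otimes> \<one> N)))"
        by (simp add: interchange del: tensA_assoc)
      finally show ?thesis by simp
    qed
    have 2: "(\<one> ?H \<otimes> ?cHK \<otimes> \<one> ?K \<cdot> (comult C \<otimes> comult D)) \<otimes> (\<one> M \<otimes> \<one> N)
        = (\<one> ?H \<otimes> (?cHK \<otimes> ((\<one> ?K \<otimes> \<one> M) \<otimes> \<one> N))) \<cdot> ?E"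
    proof -
      have "(\<one> ?H \<otimes> ?cHK \<otimes> \<one> ?K \<cdot> (comult C \<otimes> comult D)) \<otimes> (\<one> M \<otimes> \<one> N)
         = (\<one> ?H \<otimes> ?cHK \<otimes> \<one> ?K \<otimes> (\<one> M \<otimes> \<one> N)) \<cdot> (comult C \<otimes> comult D \<otimes> (\<one> M \<otimes> \<one> N))"
        by (simp add: interchange del: tensA_assoc)
      then show ?thesis by simp
    qed
    show ?thesis
      using 1 2 by (simp add: coalg_distrib_def tensor_coalg_def Comp_assoc_Arr)
  qed
  \<comment> \<open>The crossings \<open>?cHK\<close> and \<open>?cKM\<close> touch disjoint
    factors, so their order may be exchanged.\<close>
  also have "(\<one> ?H \<otimes> ((\<one> ?K \<otimes> \<one> ?H) \<otimes> (?cKM \<otimes> \<one> N)))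
          \<cdot> ((\<one> ?H \<otimes> (?cHK \<otimes> ((\<one> ?K \<otimes> \<one> M) \<otimes> \<one> N))) \<cdot> ?E) = ?S \<cdot> (?T \<cdot> ?E)"
  proof -
    have "(\<one> ?H \<otimes> ((\<one> ?K \<otimes> \<one> ?H) \<otimes> (?cKM \<otimes> \<one> N)))
        \<cdot> (\<one> ?H \<otimes> (?cHK \<otimes> ((\<one> ?K \<otimes> \<one> M) \<otimes> \<one> N)))
        = ?S \<cdot> (\<one> ?H \<otimes> ((\<one> ?H \<otimes> \<one> ?K) \<otimes> (?cKM \<otimes> \<one> N)))"
      by (simp add: interchange tensA_Id del: tensA_assoc)
    also have "\<one> ?H \<otimes> ((\<one> ?H \<otimes> \<one> ?K) \<otimes> (?cKM \<otimes> \<one> N)) = ?T"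
      by simp
    finally show ?thesis
      by (simp add: Comp_assoc_Arr[symmetric])
  qed
  \<comment> \<open>Likewise the comultiplication of \<open>C\<close> is independent of what happens
    to K, M and N, so it can be postponed until after the crossing in \<open>?T\<close>.\<close>
  also have "?T \<cdot> ?E
      = (comult C \<otimes> (\<one> ?K \<otimes> (?cKM \<otimes> \<one> N))) \<cdot> (\<one> ?H \<otimes> (comult D \<otimes> (\<one> M \<otimes> \<one> N)))"
  proof -
    have "?T = (\<one> ?H \<otimes> \<one> ?H) \<otimes> (\<one> ?K \<otimes> (?cKM \<otimes> \<one> N))"
      by simp
    then show ?thesis
      by (simp add: interchange tensA_Id del: tensA_assoc)
  qed
  also have "\<dots> = (comult C \<otimes> (\<one> ?K \<otimes> (\<one> M \<otimes> (\<one> ?K \<otimes> \<one> N))))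
      \<cdot> (\<one> ?H \<otimes> coalg_distrib V D M N)"
  proof -
    have "comult C \<otimes> (\<one> ?K \<otimes> (?cKM \<otimes> \<one> N))
        = (comult C \<otimes> (\<one> ?K \<otimes> ((\<one> M \<otimes> \<one> ?K) \<otimes> \<one> N))) \<cdot> (\<one> ?H \<otimes> (\<one> ?K \<otimes> (?cKM \<otimes> \<one> N)))"
      by (simp add: interchange tensA_Id del: tensA_assoc)
    moreover have "\<one> ?H \<otimes> coalg_distrib V D M N
        = (\<one> ?H \<otimes> (\<one> ?K \<otimes> (?cKM \<otimes> \<one> N))) \<cdot> (\<one> ?H \<otimes> (comult D \<otimes> (\<one> M \<otimes> \<one> N)))"
      by (simp add: coalg_distrib_def interchange)
    ultimately show ?thesis
      by (simp add: Comp_assoc_Arr)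
  qed
  \<comment> \<open>The two crossings of the second H, first with K and then with M, form its
    crossing with the product of K and M by the right hexagon.\<close>
  also have "?B \<cdot> (?S \<cdot> \<dots>) = coalg_distrib V C (?K \<otimes>\<^sub>o M) (?K \<otimes>\<^sub>o N)
      \<cdot> (\<one> ?H \<otimes> coalg_distrib V D M N)"
  proof -
    have "?B \<cdot> ?S = (\<one> ?H \<otimes> ((\<one> ?K \<otimes> ?cHM) \<otimes> (\<one> ?K \<otimes> \<one> N)))
        \<cdot> (\<one> ?H \<otimes> ((?cHK \<otimes> \<one> M) \<otimes> (\<one> ?K \<otimes> \<one> N)))"
      by simp
    also have "\<dots> = \<one> ?H \<otimes> (((\<one> ?K \<otimes> ?cHM) \<cdot> (?cHK \<otimes> \<one> M)) \<otimes> (\<one> ?K \<otimes> \<one> N))"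
      by (simp add: interchange tensA_Id del: tensA_assoc)
    finally have BS: "?B \<cdot> ?S = \<one> ?H \<otimes> (braid V ?H (?K \<otimes>\<^sub>o M) \<otimes> \<one> (?K \<otimes>\<^sub>o N))"
      by (simp add: hexagon_right tensA_Id)
    show ?thesis
      by (simp add: coalg_distrib_def[of V C] BS[symmetric] Comp_assoc_Arr)
        (simp add: ids Comp_assoc_Arr)
  qed
  finally show ?thesis .
qed

text \<open>Both sides distribute three copies of \<open>H\<close>, obtained by comultiplying twice.
  They differ in which copy is comultiplied again, which is coassociativity, and in how the last
  copy reaches its place, which is the right hexagon.\<close>

lemma coalg_distrib_assoc:
  assumes C: "coalgebra V C"
    and [simp]: "M \<in> Obj V" "N \<in> Obj V" "P \<in> Obj V"
  shows "(\<one> (cob C) \<otimes> (\<one> M \<otimes> coalg_distrib V C N P)) \<cdot> coalg_distrib V C M (N \<otimes>\<^sub>o P)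
       = (coalg_distrib V C M N \<otimes> (\<one> (cob C) \<otimes> \<one> P)) \<cdot> coalg_distrib V C (M \<otimes>\<^sub>o N) P"
proof -
  let ?H = "cob C" and ?d = "comult C"
  let ?cM = "braid V ?H M" and ?cN = "braid V ?H N"
  note [simp] = coalgebra.coalgebra_simps[OF C]
  note ids = tensA_Id[symmetric]
  let ?N = "\<one> ?H \<otimes> (\<one> M \<otimes> (\<one> ?H \<otimes> (?cN \<otimes> \<one> P)))"
  let ?M1 = "\<one> ?H \<otimes> (?cM \<otimes> (\<one> ?H \<otimes> (\<one> N \<otimes> \<one> P)))"
  let ?M2 = "\<one> ?H \<otimes> (\<one> ?H \<otimes> (?cM \<otimes> (\<one> N \<otimes> \<one> P)))"
  let ?I = "\<one> M \<otimes> (\<one> N \<otimes> \<one> P)"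
  have "(\<one> ?H \<otimes> (\<one> M \<otimes> coalg_distrib V C N P)) \<cdot> coalg_distrib V C M (N \<otimes>\<^sub>o P)
      = ?N \<cdot> ((\<one> ?H \<otimes> ((\<one> M \<otimes> ?d) \<otimes> (\<one> N \<otimes> \<one> P)))
         \<cdot> ((\<one> ?H \<otimes> (?cM \<otimes> (\<one> N \<otimes> \<one> P))) \<cdot> (?d \<otimes> ?I)))"
  proof -
    have "\<one> ?H \<otimes> (\<one> M \<otimes> coalg_distrib V C N P)
        = ?N \<cdot> (\<one> ?H \<otimes> (\<one> M \<otimes> (?d \<otimes> (\<one> N \<otimes> \<one> P))))"
      by (simp add: coalg_distrib_def interchange)
    then show ?thesis
      by (simp add: coalg_distrib_def[of V C M] Comp_assoc_Arr ids)
  qed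
  \<comment> \<open>The second comultiplication is pulled back through the crossing with M, by
    naturality of the braiding and the left hexagon. Both copies then cross M one after the other:
    \<open>?M2\<close> moves the last copy, \<open>?M1\<close> the middle one.\<close>
  also have "(\<one> ?H \<otimes> ((\<one> M \<otimes> ?d) \<otimes> (\<one> N \<otimes> \<one> P)))
         \<cdot> ((\<one> ?H \<otimes> (?cM \<otimes> (\<one> N \<otimes> \<one> P))) \<cdot> (?d \<otimes> ?I))
      = ?M1 \<cdot> (?M2 \<cdot> (((\<one> ?H \<otimes> ?d) \<cdot> ?d) \<otimes> ?I))"
  proof -
    have "(\<one> M \<otimes> ?d) \<cdot> ?cM = braid V (?H \<otimes>\<^sub>o ?H) M \<cdot> (?d \<otimes> \<one> M)"
      by (rule braid_natural_Arr[symmetric]) simp_all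
    also have "\<dots> = (?cM \<otimes> \<one> ?H) \<cdot> ((\<one> ?H \<otimes> ?cM) \<cdot> (?d \<otimes> \<one> M))"
      by (simp add: hexagon_left Comp_assoc_Arr)
    finally have c: "(\<one> M \<otimes> ?d) \<cdot> ?cM = \<dots>" .
    have "(\<one> ?H \<otimes> ((\<one> M \<otimes> ?d) \<otimes> (\<one> N \<otimes> \<one> P))) \<cdot> (\<one> ?H \<otimes> (?cM \<otimes> (\<one> N \<otimes> \<one> P)))
        = \<one> ?H \<otimes> (((\<one> M \<otimes> ?d) \<cdot> ?cM) \<otimes> (\<one> N \<otimes> \<one> P))"
      by (simp add: interchange tensA_Id del: tensA_assoc)
    also have "\<dots> = (\<one> ?H \<otimes> ((?cM \<otimes> \<one> ?H) \<otimes> (\<one> N \<otimes> \<one> P)))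
        \<cdot> ((\<one> ?H \<otimes> ((\<one> ?H \<otimes> ?cM) \<otimes> (\<one> N \<otimes> \<one> P))) \<cdot> (\<one> ?H \<otimes> ((?d \<otimes> \<one> M) \<otimes> (\<one> N \<otimes> \<one> P))))"
      unfolding c by (simp add: interchange tensA_Id del: tensA_assoc)
    also have "\<dots> = ?M1 \<cdot> (?M2 \<cdot> ((\<one> ?H \<otimes> ?d) \<otimes> ?I))"
      by simp
    finally have "(\<one> ?H \<otimes> ((\<one> M \<otimes> ?d) \<otimes> (\<one> N \<otimes> \<one> P)))
         \<cdot> ((\<one> ?H \<otimes> (?cM \<otimes> (\<one> N \<otimes> \<one> P))) \<cdot> (?d \<otimes> ?I))
       = (?M1 \<cdot> (?M2 \<cdot> ((\<one> ?H \<otimes> ?d) \<otimes> ?I))) \<cdot> (?d \<otimes> ?I)"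
      by (simp add: Comp_assoc_Arr[symmetric])
    also have "\<dots> = ?M1 \<cdot> (?M2 \<cdot> (((\<one> ?H \<otimes> ?d) \<otimes> ?I) \<cdot> (?d \<otimes> ?I)))"
      by (simp add: Comp_assoc_Arr)
    also have "((\<one> ?H \<otimes> ?d) \<otimes> ?I) \<cdot> (?d \<otimes> ?I) = ((\<one> ?H \<otimes> ?d) \<cdot> ?d) \<otimes> ?I"
      by (simp add: interchange tensA_Id del: tensA_assoc)
    finally show ?thesis .
  qed
  also have "(\<one> ?H \<otimes> ?d) \<cdot> ?d = (?d \<otimes> \<one> ?H) \<cdot> ?d"
    using coalgebra.coassociative[OF C] by simp
  \<comment> \<open>The middle copy crossing M (\<open>?M1\<close>) and the last copy crossing N
    (\<open>?N\<close>) are independent. After exchanging them, the last copy crosses M and then N,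
    which is a single crossing by the right hexagon.\<close>
  also have "?N \<cdot> (?M1 \<cdot> (?M2 \<cdot> (((?d \<otimes> \<one> ?H) \<cdot> ?d) \<otimes> ?I)))
      = (\<one> ?H \<otimes> (?cM \<otimes> (\<one> N \<otimes> (\<one> ?H \<otimes> \<one> P))))
        \<cdot> ((\<one> ?H \<otimes> (\<one> ?H \<otimes> (braid V ?H (M \<otimes>\<^sub>o N) \<otimes> \<one> P))) \<cdot> (((?d \<otimes> \<one> ?H) \<cdot> ?d) \<otimes> ?I))"
  proof -
    have "?N \<cdot> ?M1 = (\<one> ?H \<otimes> ((\<one> M \<otimes> \<one> ?H) \<otimes> (?cN \<otimes> \<one> P)))
         \<cdot> (\<one> ?H \<otimes> (?cM \<otimes> ((\<one> ?H \<otimes> \<one> N) \<otimes> \<one> P)))"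
      by simp
    also have "\<dots> = (\<one> ?H \<otimes> (?cM \<otimes> ((\<one> N \<otimes> \<one> ?H) \<otimes> \<one> P)))
         \<cdot> (\<one> ?H \<otimes> ((\<one> ?H \<otimes> \<one> M) \<otimes> (?cN \<otimes> \<one> P)))"
      by (simp add: interchange tensA_Id del: tensA_assoc)
    also have "\<dots> = (\<one> ?H \<otimes> (?cM \<otimes> (\<one> N \<otimes> (\<one> ?H \<otimes> \<one> P))))
         \<cdot> (\<one> ?H \<otimes> (\<one> ?H \<otimes> ((\<one> M \<otimes> ?cN) \<otimes> \<one> P)))"
      by simp
    finally have 1: "?N \<cdot> ?M1 = \<dots>" .
    have "(\<one> ?H \<otimes> (\<one> ?H \<otimes> ((\<one> M \<otimes> ?cN) \<otimes> \<one> P))) \<cdot> ?M2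
        = (\<one> ?H \<otimes> (\<one> ?H \<otimes> ((\<one> M \<otimes> ?cN) \<otimes> \<one> P)))
          \<cdot> (\<one> ?H \<otimes> (\<one> ?H \<otimes> ((?cM \<otimes> \<one> N) \<otimes> \<one> P)))"
      by simp
    also have "\<dots> = \<one> ?H \<otimes> (\<one> ?H \<otimes> (((\<one> M \<otimes> ?cN) \<cdot> (?cM \<otimes> \<one> N)) \<otimes> \<one> P))"
      by (simp add: interchange tensA_Id del: tensA_assoc)
    finally have 2: "(\<one> ?H \<otimes> (\<one> ?H \<otimes> ((\<one> M \<otimes> ?cN) \<otimes> \<one> P))) \<cdot> ?M2
        = \<one> ?H \<otimes> (\<one> ?H \<otimes> (braid V ?H (M \<otimes>\<^sub>o N) \<otimes> \<one> P))"
      by (simp add: hexagon_right)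
    let ?Y = "((?d \<otimes> \<one> ?H) \<cdot> ?d) \<otimes> ?I"
    have "?N \<cdot> (?M1 \<cdot> (?M2 \<cdot> ?Y)) = (?N \<cdot> ?M1) \<cdot> (?M2 \<cdot> ?Y)"
      by (simp add: Comp_assoc_Arr)
    also have "\<dots> = (\<one> ?H \<otimes> (?cM \<otimes> (\<one> N \<otimes> (\<one> ?H \<otimes> \<one> P))))
         \<cdot> (((\<one> ?H \<otimes> (\<one> ?H \<otimes> ((\<one> M \<otimes> ?cN) \<otimes> \<one> P))) \<cdot> ?M2) \<cdot> ?Y)"
      unfolding 1 by (simp add: Comp_assoc_Arr)
    finally show ?thesis
      unfolding 2 .
  qed
  \<comment> \<open>After coassociativity the outer comultiplication acts on the first copy alone,
    so it slides past the crossing of the last copy.\<close>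
  also have "(\<one> ?H \<otimes> (\<one> ?H \<otimes> (braid V ?H (M \<otimes>\<^sub>o N) \<otimes> \<one> P))) \<cdot> (((?d \<otimes> \<one> ?H) \<cdot> ?d) \<otimes> ?I)
      = (?d \<otimes> (\<one> M \<otimes> (\<one> N \<otimes> (\<one> ?H \<otimes> \<one> P)))) \<cdot> coalg_distrib V C (M \<otimes>\<^sub>o N) P"
  proof -
    have 1: "((?d \<otimes> \<one> ?H) \<cdot> ?d) \<otimes> ?I = (?d \<otimes> (\<one> ?H \<otimes> ?I)) \<cdot> (?d \<otimes> ?I)"
    proof -
      have "((?d \<otimes> \<one> ?H) \<cdot> ?d) \<otimes> ?I = ((?d \<otimes> \<one> ?H) \<otimes> ?I) \<cdot> (?d \<otimes> ?I)"
        by (simp add: interchange tensA_Id del: tensA_assoc)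
      then show ?thesis by simp
    qed
    have "(\<one> ?H \<otimes> (\<one> ?H \<otimes> (braid V ?H (M \<otimes>\<^sub>o N) \<otimes> \<one> P))) \<cdot> (?d \<otimes> (\<one> ?H \<otimes> ?I))
       = ((\<one> ?H \<otimes> \<one> ?H) \<otimes> (braid V ?H (M \<otimes>\<^sub>o N) \<otimes> \<one> P)) \<cdot> (?d \<otimes> (((\<one> ?H \<otimes> \<one> (M \<otimes>\<^sub>o N)) \<otimes> \<one> P)))"
      by (simp add: ids)
    also have "\<dots> = (?d \<otimes> (\<one> (M \<otimes>\<^sub>o N \<otimes>\<^sub>o ?H) \<otimes> \<one> P)) \<cdot> (\<one> ?H \<otimes> (braid V ?H (M \<otimes>\<^sub>o N) \<otimes> \<one> P))"
      by (simp add: interchange tensA_Id del: tensA_assoc)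
    also have "\<dots> = (?d \<otimes> (\<one> M \<otimes> (\<one> N \<otimes> (\<one> ?H \<otimes> \<one> P))))
        \<cdot> (\<one> ?H \<otimes> (braid V ?H (M \<otimes>\<^sub>o N) \<otimes> \<one> P))"
      by (simp add: ids)
    finally have 2: "(\<one> ?H \<otimes> (\<one> ?H \<otimes> (braid V ?H (M \<otimes>\<^sub>o N) \<otimes> \<one> P))) \<cdot> (?d \<otimes> (\<one> ?H \<otimes> ?I)) = \<dots>" .
    have "(\<one> ?H \<otimes> (\<one> ?H \<otimes> (braid V ?H (M \<otimes>\<^sub>o N) \<otimes> \<one> P))) \<cdot> (((?d \<otimes> \<one> ?H) \<cdot> ?d) \<otimes> ?I)
      = ((\<one> ?H \<otimes> (\<one> ?H \<otimes> (braid V ?H (M \<otimes>\<^sub>o N) \<otimes> \<one> P))) \<cdot> (?d \<otimes> (\<one> ?H \<otimes> ?I))) \<cdot> (?d \<otimes> ?I)"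
      unfolding 1 by (simp add: Comp_assoc_Arr)
    also have "\<dots> = (?d \<otimes> (\<one> M \<otimes> (\<one> N \<otimes> (\<one> ?H \<otimes> \<one> P))))
        \<cdot> ((\<one> ?H \<otimes> (braid V ?H (M \<otimes>\<^sub>o N) \<otimes> \<one> P)) \<cdot> (?d \<otimes> ?I))"
      unfolding 2 by (simp add: Comp_assoc_Arr)
    finally show ?thesis
      by (simp add: coalg_distrib_def ids)
  qed
  \<comment> \<open>The outer comultiplication and the crossing of the middle copy with M are the
    distribution over M and N, with the last copy and P as spectators.\<close>
  also have "(\<one> ?H \<otimes> (?cM \<otimes> (\<one> N \<otimes> (\<one> ?H \<otimes> \<one> P))))
       \<cdot> ((?d \<otimes> (\<one> M \<otimes> (\<one> N \<otimes> (\<one> ?H \<otimes> \<one> P)))) \<cdot> coalg_distrib V C (M \<otimes>\<^sub>o N) P)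
      = (coalg_distrib V C M N \<otimes> (\<one> ?H \<otimes> \<one> P)) \<cdot> coalg_distrib V C (M \<otimes>\<^sub>o N) P"
  proof -
    have "coalg_distrib V C M N \<otimes> (\<one> ?H \<otimes> \<one> P)
        = (\<one> ?H \<otimes> (?cM \<otimes> \<one> N) \<otimes> (\<one> ?H \<otimes> \<one> P)) \<cdot> (?d \<otimes> (\<one> M \<otimes> \<one> N) \<otimes> (\<one> ?H \<otimes> \<one> P))"
      by (simp add: coalg_distrib_def interchange tensA_Id del: tensA_assoc)
    also have "\<dots> = (\<one> ?H \<otimes> (?cM \<otimes> (\<one> N \<otimes> (\<one> ?H \<otimes> \<one> P))))
        \<cdot> (?d \<otimes> (\<one> M \<otimes> (\<one> N \<otimes> (\<one> ?H \<otimes> \<one> P))))"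
      by simp
    finally show ?thesis
      by (simp add: Comp_assoc_Arr)
  qed
  finally show ?thesis .
qed

text \<open>The braiding with \<open>\<k>\<close> is trivial, so \<open>q\<close> splits off and the
  left counit law cancels the comultiplication. In the application \<open>q\<close> is the action of
  a module.\<close>

lemma counit_coalg_distrib_left:
  assumes C: "coalgebra V C" and q: "q \<in> Hom V (cob C \<otimes>\<^sub>o N) N'" and [simp]: "N \<in> Obj V"
  shows "(counit C \<otimes> q) \<cdot> coalg_distrib V C \<k> N = q"
proof -
  note [simp] = coalgebra.coalgebra_simps[OF C] HomD[OF q]
  have "counit C \<otimes> q = q \<cdot> (counit C \<otimes> \<one> (cob C) \<otimes> \<one> N)"
  proof -
    \<comment> \<open>\<open>unit_tensA\<close> is withheld because the identity on
      \<open>\<k>\<close> is needed as the partner of the counit in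
      \<open>interchange\<close>.\<close>
    have "counit C \<otimes> q = (\<one> \<k> \<otimes> q) \<cdot> (counit C \<otimes> (\<one> (cob C) \<otimes> \<one> N))"
      by (simp add: interchange tensA_Id del: unit_tensA)
    then show ?thesis by simp
  qed
  moreover have "(counit C \<otimes> \<one> (cob C) \<otimes> \<one> N) \<cdot> (comult C \<otimes> \<one> N)
      = \<one> (cob C \<otimes>\<^sub>o N)"
    by (simp add: interchange coalgebra.counit_left[OF C] tensA_Id del: tensA_assoc)
  ultimately show ?thesis
    by (simp add: coalg_distrib_def tensA_Id Comp_assoc_Arr)
qed

text \<open>Here the counit hits the copy of \<open>H\<close> that has crossed \<open>M\<close>.
  Naturality of the braiding moves it in front of the crossing, which becomes trivial, and the right
  counit law applies.\<close>

lemma counit_coalg_distrib_right: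
  assumes C: "coalgebra V C" and p: "p \<in> Hom V (cob C \<otimes>\<^sub>o M) M'" and [simp]: "M \<in> Obj V"
  shows "(p \<otimes> counit C) \<cdot> coalg_distrib V C M \<k> = p"
proof -
  let ?H = "cob C"
  note [simp] = coalgebra.coalgebra_simps[OF C] HomD[OF p]
  have "p \<otimes> counit C = (p \<otimes> \<one> \<k>) \<cdot> ((\<one> ?H \<otimes> \<one> M) \<otimes> counit C)"
    by (simp add: interchange tensA_Id del: tensA_unit tensA_assoc)
  then have p: "p \<otimes> counit C = p \<cdot> (\<one> ?H \<otimes> (\<one> M \<otimes> counit C))"
    by simp
  have "(\<one> M \<otimes> counit C) \<cdot> braid V ?H M = counit C \<otimes> \<one> M"
    using braid_natural_Arr[of "counit C" "\<one> M" ?H \<k> M M] by simp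
  then have "(\<one> ?H \<otimes> (\<one> M \<otimes> counit C)) \<cdot> (\<one> ?H \<otimes> braid V ?H M) = \<one> ?H \<otimes> counit C \<otimes> \<one> M"
    by (simp add: interchange)
  moreover have "(\<one> ?H \<otimes> counit C \<otimes> \<one> M) \<cdot> (comult C \<otimes> \<one> M) = \<one> (?H \<otimes>\<^sub>o M)"
    by (simp add: interchange coalgebra.counit_right[OF C] tensA_Id del: tensA_assoc)
  ultimately have "(\<one> ?H \<otimes> (\<one> M \<otimes> counit C)) \<cdot> ((\<one> ?H \<otimes> braid V ?H M) \<cdot> (comult C \<otimes> \<one> M))
      = \<one> (?H \<otimes>\<^sub>o M)"
    by (simp add: Comp_assoc_Arr[symmetric])
  then show ?thesis
    by (simp add: coalg_distrib_def p Comp_assoc_Arr)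
qed

end

section \<open>Families and modules\<close>

lemma Obj_family_category [simp]: "Obj (family_category V X) = X \<times> X \<rightarrow>\<^sub>E Obj V"
  by (simp add: family_category_def)

lemma family_category_simps:
  "\<one>\<^bsub>family_category V X\<^esub> M = (\<lambda>p\<in>X \<times> X. \<one>\<^bsub>V\<^esub> (M p))"
  "\<psi> \<cdot>\<^bsub>family_category V X\<^esub> \<phi> = (\<lambda>p\<in>X \<times> X. \<psi> p \<cdot>\<^bsub>V\<^esub> \<phi> p)"
  "M \<otimes>\<^sub>o\<^bsub>family_category V X\<^esub> N = (\<lambda>p\<in>X \<times> X. M p \<otimes>\<^sub>o\<^bsub>V\<^esub> N p)"
  "\<phi> \<otimes>\<^bsub>family_category V X\<^esub> \<psi> = (\<lambda>p\<in>X \<times> X. \<phi> p \<otimes>\<^bsub>V\<^esub> \<psi> p)"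
  "\<k>\<^bsub>family_category V X\<^esub> = (\<lambda>p\<in>X \<times> X. \<k>\<^bsub>V\<^esub>)"
  by (simp_all add: family_category_def)

text \<open>The objects \<open>M\<close> and \<open>N\<close> come out extensional because
  \<open>Dom\<close> and \<open>Cod\<close> are defined as restricted functions.\<close>

lemma Hom_family_category:
  "\<phi> \<in> Hom (family_category V X) M N \<longleftrightarrow>
     \<phi> \<in> extensional (X \<times> X) \<and> M \<in> extensional (X \<times> X) \<and> N \<in> extensional (X \<times> X) \<and>
     (\<forall>p\<in>X \<times> X. \<phi> p \<in> Hom V (M p) (N p))"
  by (auto simp: Hom_def family_category_def PiE_def Pi_def fun_eq_iff restrict_def extensional_def)

context strict_braided_monoidal_category
begin

lemma category_family_category: "category (family_category V X)"
proof
  fix \<phi> \<psi> \<chi> M N P Q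
  assume "\<phi> \<in> Hom (family_category V X) M N" "\<psi> \<in> Hom (family_category V X) N P"
    "\<chi> \<in> Hom (family_category V X) P Q"
  then show "(\<chi> \<cdot>\<^bsub>family_category V X\<^esub> \<psi>) \<cdot>\<^bsub>family_category V X\<^esub> \<phi>
      = \<chi> \<cdot>\<^bsub>family_category V X\<^esub> (\<psi> \<cdot>\<^bsub>family_category V X\<^esub> \<phi>)"
    by (auto simp: Hom_family_category family_category_simps fun_eq_iff restrict_def intro!: Comp_assoc)
next
  fix \<phi> M N
  assume "\<phi> \<in> Hom (family_category V X) M N"
  then show "\<phi> \<cdot>\<^bsub>family_category V X\<^esub> \<one>\<^bsub>family_category V X\<^esub> M = \<phi>"
    "\<one>\<^bsub>family_category V X\<^esub> N \<cdot>\<^bsub>family_category V X\<^esub> \<phi> = \<phi>"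
    unfolding Hom_family_category
    by (auto simp: family_category_simps fun_eq_iff restrict_def extensional_def
        intro!: Comp_Id Id_Comp)
next
  fix \<phi>
  assume "\<phi> \<in> Arr (family_category V X)"
  then show "Dom (family_category V X) \<phi> \<in> Obj (family_category V X)"
    "Cod (family_category V X) \<phi> \<in> Obj (family_category V X)"
    by (auto simp: family_category_def intro!: Dom_in_Obj Cod_in_Obj)
qed (auto simp: Hom_family_category PiE_def Pi_def family_category_simps
    intro!: Id_in_Hom Comp_in_Hom)

text \<open>All structure is pointwise, so strictness of \<open>V\<close> is inherited and the
  criterion for identity coherence arrows applies.\<close>

lemma monoidal_family_category: "monoidal_category (family_category V X)"
proof (rule strict_monoidal_categoryI[OF category_family_category], goal_cases)
  \<comment> \<open>Goal 2 is typing of the tensor product of arrows, and goal 4 is its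
    compatibility with composition.\<close>
  case 2
  then show ?case
    by (auto simp: Hom_family_category family_category_simps intro!: tensA_in_Hom)
next
  case 4
  then show ?case
    by (auto simp: Hom_family_category family_category_simps fun_eq_iff restrict_def intro!: tensA_Comp)
qed (auto simp: family_category_def PiE_def Pi_def tensA_Id fun_eq_iff restrict_def extensional_def
    strict_assoc strict_lunit strict_runit)

end

section \<open>Tensor product and unit of left modules\<close>

locale strict_braided_cv_category =
  strict_braided_monoidal_category V + cv_category V X A
  for V :: "('o, 'm, 'z) braided_category_scheme" (structure)
    and X :: "'x set"
    and A :: "('x, 'o, 'm, 'y) cvcat_scheme"
begin

abbreviation F where "F \<equiv> family_category V X"

sublocale family: monoidal_category F
  by (rule monoidal_family_category)

lemma hom_coalg_simps [simp]:
  "cob (hom_coalg A x y) = hob A (x, y)" "comult (hom_coalg A x y) = hcomult A (x, y)"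
  "counit (hom_coalg A x y) = hcounit A (x, y)"
  by (simp_all add: hom_coalg_def)

lemma hob_simps [simp]:
  assumes "x \<in> X" "y \<in> X"
  shows "hob A (x, y) \<in> Obj V" "hcounit A (x, y) \<in> Arr V"
    "hcomult A (x, y) \<in> Hom V (hob A (x, y)) (hob A (x, y) \<otimes>\<^sub>o hob A (x, y))"
    "Dom V (hcounit A (x, y)) = hob A (x, y)" "Cod V (hcounit A (x, y)) = \<k>"
    "coalgebra V (hom_coalg A x y)"
  using coalgebra.coalgebra_simps[OF hom_coalgebra[OF assms]] hom_coalgebra[OF assms] by simp_all

lemma mult_simps [simp]:
  assumes "x \<in> X" "y \<in> X" "z \<in> X"
  shows "mult A (x, y, z) \<in> Arr V"
    "Dom V (mult A (x, y, z)) = hob A (x, y) \<otimes>\<^sub>o hob A (y, z)"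
    "Cod V (mult A (x, y, z)) = hob A (x, z)"
  using HomD[OF mult_in_Hom[OF assms]] by simp_all

lemma unit_simps [simp]:
  assumes "x \<in> X"
  shows "unit A x \<in> Arr V" "Dom V (unit A x) = \<k>" "Cod V (unit A x) = hob A (x, x)"
  using HomD[OF unit_in_Hom[OF assms]] by simp_all

lemma mob_simps [simp]:
  assumes "left_module V X A M" "x \<in> X" "y \<in> X"
  shows "mob M (x, y) \<in> Obj V"
  using left_module.mob_in_Obj[OF assms(1)] assms(2,3) by auto

lemma act_simps [simp]:
  assumes "left_module V X A M" "x \<in> X" "y \<in> X" "z \<in> X"
  shows "act M (x, y, z) \<in> Arr V"
    "Dom V (act M (x, y, z)) = hob A (x, y) \<otimes>\<^sub>o mob M (y, z)"
    "Cod V (act M (x, y, z)) = mob M (x, z)"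
  using HomD[OF left_module.act_in_Hom[OF assms]] by simp_all

text \<open>The action is restricted to triples from \<open>X\<close>, which makes it extensional as
  \<open>left_module\<close> demands and lets tensor products be compared as records.\<close>

definition tensor_module :: "('x, 'o, 'm) vmod \<Rightarrow> ('x, 'o, 'm) vmod \<Rightarrow> ('x, 'o, 'm) vmod" where
  "tensor_module M N =
     \<lparr>mob = mob M \<otimes>\<^sub>o\<^bsub>F\<^esub> mob N,
      act = (\<lambda>(x, y, z)\<in>X \<times> X \<times> X.
        (act M (x, y, z) \<otimes> act N (x, y, z))
        \<cdot> coalg_distrib V (hom_coalg A x y) (mob M (y, z)) (mob N (y, z)))\<rparr>"

text \<open>By strictness tensoring with \<open>\<k>\<close> does nothing to
  \<open>hob A (x, y)\<close>, so the counit already has the type of an action on the unit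
  family.\<close>

definition unit_module :: "('x, 'o, 'm) vmod" where
  "unit_module =
     \<lparr>mob = \<k>\<^bsub>F\<^esub>, act = (\<lambda>(x, y, z)\<in>X \<times> X \<times> X. hcounit A (x, y))\<rparr>"

lemma mob_tensor_module [simp]:
  "mob (tensor_module M N) = mob M \<otimes>\<^sub>o\<^bsub>F\<^esub> mob N"
  by (simp add: tensor_module_def)

lemma tensO_family [simp]:
  "\<lbrakk>x \<in> X; y \<in> X\<rbrakk> \<Longrightarrow> (M \<otimes>\<^sub>o\<^bsub>F\<^esub> N) (x, y) = M (x, y) \<otimes>\<^sub>o N (x, y)"
  by (simp add: family_category_def)

lemma tensA_family [simp]:
  "\<lbrakk>x \<in> X; y \<in> X\<rbrakk> \<Longrightarrow> (\<phi> \<otimes>\<^bsub>F\<^esub> \<psi>) (x, y) = \<phi> (x, y) \<otimes> \<psi> (x, y)"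
  by (simp add: family_category_def)

lemma unitO_family [simp]: "\<lbrakk>x \<in> X; y \<in> X\<rbrakk> \<Longrightarrow> \<k>\<^bsub>F\<^esub> (x, y) = \<k>"
  by (simp add: family_category_def)

lemma Id_family [simp]: "\<lbrakk>x \<in> X; y \<in> X\<rbrakk> \<Longrightarrow> \<one>\<^bsub>F\<^esub> M (x, y) = \<one> (M (x, y))"
  by (simp add: family_category_def)

lemma Comp_family [simp]:
  "\<lbrakk>x \<in> X; y \<in> X\<rbrakk> \<Longrightarrow> (\<psi> \<cdot>\<^bsub>F\<^esub> \<phi>) (x, y) = \<psi> (x, y) \<cdot> \<phi> (x, y)"
  by (simp add: family_category_def)

lemma act_tensor_module [simp]:
  "\<lbrakk>x \<in> X; y \<in> X; z \<in> X\<rbrakk> \<Longrightarrow> act (tensor_module M N) (x, y, z) =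
     (act M (x, y, z) \<otimes> act N (x, y, z))
     \<cdot> coalg_distrib V (hom_coalg A x y) (mob M (y, z)) (mob N (y, z))"
  by (simp add: tensor_module_def)

lemma mob_unit_module [simp]: "mob unit_module = \<k>\<^bsub>F\<^esub>"
  by (simp add: unit_module_def)

lemma act_unit_module [simp]:
  "\<lbrakk>x \<in> X; y \<in> X; z \<in> X\<rbrakk> \<Longrightarrow> act unit_module (x, y, z) = hcounit A (x, y)"
  by (simp add: unit_module_def)

text \<open>The two module laws are the compatibility of the counits with the composition and with
  the units of \<open>A\<close>, both part of being coalgebra morphisms.\<close>

lemma left_module_unit: "left_module V X A unit_module"
proof
  show "mob unit_module \<in> Obj F"
    using family.unitO_in_Obj by simp
  show "act unit_module \<in> extensional (X \<times> X \<times> X)"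
    by (simp add: unit_module_def)
next
  fix x y z assume [simp]: "x \<in> X" "y \<in> X" "z \<in> X"
  show "act unit_module (x, y, z)
      \<in> Hom V (hob A (x, y) \<otimes>\<^sub>o mob unit_module (y, z)) (mob unit_module (x, z))"
    by (simp add: Hom_def)
next
  fix x y z u assume [simp]: "x \<in> X" "y \<in> X" "z \<in> X" "u \<in> X"
  have "hcounit A (x, z) \<cdot> mult A (x, y, z) = hcounit A (x, y) \<otimes> hcounit A (y, z)"
    using mult_coalg_morphism[of x y z] by (simp add: coalg_morphism_def tensor_coalg_def)
  also have "\<dots> = (hcounit A (x, y) \<otimes> \<one> \<k>) \<cdot> (\<one> (hob A (x, y)) \<otimes> hcounit A (y, z))"
    by (simp add: interchange del: tensA_unit)
  finally show "act unit_module (x, y, u) \<cdot> (\<one> (hob A (x, y)) \<otimes> act unit_module (y, z, u))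
      = act unit_module (x, z, u) \<cdot> (mult A (x, y, z) \<otimes> \<one> (mob unit_module (z, u)))"
    by simp
next
  fix x y assume [simp]: "x \<in> X" "y \<in> X"
  show "act unit_module (x, x, y) \<cdot> (unit A x \<otimes> \<one> (mob unit_module (x, y)))
      = \<one> (mob unit_module (x, y))"
    using unit_coalg_morphism[of x] by (simp add: coalg_morphism_def unit_coalg_def)
qed

text \<open>Naturality of \<open>\<sigma>\<close> moves the inner actions outwards, the two
  remaining distributions merge into that of a tensor product coalgebra, the laws of
  \<open>M\<close> and \<open>N\<close> apply factorwise, and the composition of \<open>A\<close>
  passes back through \<open>\<sigma>\<close> as a coalgebra morphism.\<close>

lemma left_module_tensor:
  assumes M [simp]: "left_module V X A M" and N [simp]: "left_module V X A N"
  shows "left_module V X A (tensor_module M N)"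
proof
  show "mob (tensor_module M N) \<in> Obj F"
    using left_module.mob_in_Obj[OF M] left_module.mob_in_Obj[OF N] family.tensO_in_Obj by simp
  show "act (tensor_module M N) \<in> extensional (X \<times> X \<times> X)"
    by (simp add: tensor_module_def)
next
  fix x y z assume [simp]: "x \<in> X" "y \<in> X" "z \<in> X"
  show "act (tensor_module M N) (x, y, z)
      \<in> Hom V (hob A (x, y) \<otimes>\<^sub>o mob (tensor_module M N) (y, z)) (mob (tensor_module M N) (x, z))"
    by (rule HomI) simp_all
next
  fix x y z u assume [simp]: "x \<in> X" "y \<in> X" "z \<in> X" "u \<in> X"
  let ?H = "hob A (x, y)" and ?K = "hob A (y, z)"
  let ?m = "mult A (x, y, z)"
  let ?M = "mob M (z, u)" and ?N = "mob N (z, u)"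
  let ?d = "\<lambda>C. coalg_distrib V C ?M ?N"
  let ?HK = "tensor_coalg V (hom_coalg A x y) (hom_coalg A y z)"
  have HK [simp]: "cob ?HK = ?H \<otimes>\<^sub>o ?K"
    "comult ?HK \<in> Hom V (?H \<otimes>\<^sub>o ?K) (?H \<otimes>\<^sub>o (?K \<otimes>\<^sub>o (?H \<otimes>\<^sub>o ?K)))"
    using comult_tensor_coalg_in_Hom[of "hom_coalg A x y" "hom_coalg A y z"]
    by (simp_all add: tensor_coalg_def)
  have "act (tensor_module M N) (x, y, u) \<cdot> (\<one> ?H \<otimes> act (tensor_module M N) (y, z, u))
      = (act M (x, y, u) \<otimes> act N (x, y, u))
        \<cdot> ((coalg_distrib V (hom_coalg A x y) (mob M (y, u)) (mob N (y, u))
             \<cdot> (\<one> ?H \<otimes> (act M (y, z, u) \<otimes> act N (y, z, u))))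
        \<cdot> (\<one> ?H \<otimes> ?d (hom_coalg A y z)))"
  proof -
    have "\<one> ?H \<otimes> act (tensor_module M N) (y, z, u)
        = (\<one> ?H \<otimes> (act M (y, z, u) \<otimes> act N (y, z, u))) \<cdot> (\<one> ?H \<otimes> ?d (hom_coalg A y z))"
      by (simp add: interchange)
    then show ?thesis
      by (simp add: Comp_assoc_Arr)
  qed
  also have "coalg_distrib V (hom_coalg A x y) (mob M (y, u)) (mob N (y, u))
             \<cdot> (\<one> ?H \<otimes> (act M (y, z, u) \<otimes> act N (y, z, u)))
      = (\<one> ?H \<otimes> act M (y, z, u) \<otimes> (\<one> ?H \<otimes> act N (y, z, u)))
        \<cdot> coalg_distrib V (hom_coalg A x y) (?K \<otimes>\<^sub>o ?M) (?K \<otimes>\<^sub>o ?N)"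
    using coalg_distrib_natural[of "hom_coalg A x y" "act M (y, z, u)" "?K \<otimes>\<^sub>o ?M" "mob M (y, u)"
        "act N (y, z, u)" "?K \<otimes>\<^sub>o ?N" "mob N (y, u)"]
    by (simp add: Hom_def)
  also have "(act M (x, y, u) \<otimes> act N (x, y, u))
        \<cdot> ((\<one> ?H \<otimes> act M (y, z, u) \<otimes> (\<one> ?H \<otimes> act N (y, z, u))
           \<cdot> coalg_distrib V (hom_coalg A x y) (?K \<otimes>\<^sub>o ?M) (?K \<otimes>\<^sub>o ?N))
          \<cdot> (\<one> ?H \<otimes> ?d (hom_coalg A y z)))
     = ((act M (x, y, u) \<otimes> act N (x, y, u)) \<cdot> (\<one> ?H \<otimes> act M (y, z, u) \<otimes> (\<one> ?H \<otimes> act N (y, z, u))))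
       \<cdot> ?d ?HK"
    by (simp add: coalg_distrib_tensor Comp_assoc_Arr)
  also have "(act M (x, y, u) \<otimes> act N (x, y, u)) \<cdot> (\<one> ?H \<otimes> act M (y, z, u) \<otimes> (\<one> ?H \<otimes> act N (y, z, u)))
      = (act M (x, z, u) \<otimes> act N (x, z, u)) \<cdot> (?m \<otimes> \<one> ?M \<otimes> (?m \<otimes> \<one> ?N))"
    using left_module.act_assoc[OF M, of x y z u] left_module.act_assoc[OF N, of x y z u]
    by (simp add: interchange del: tensA_assoc)
  also have "\<dots> \<cdot> ?d ?HK
      = (act M (x, z, u) \<otimes> act N (x, z, u)) \<cdot> (?d (hom_coalg A x z) \<cdot> (?m \<otimes> (\<one> ?M \<otimes> \<one> ?N)))"
  proof -
    have "(?m \<otimes> (\<one> ?M \<otimes> (?m \<otimes> \<one> ?N))) \<cdot> ?d ?HK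
        = ?d (hom_coalg A x z) \<cdot> (?m \<otimes> (\<one> ?M \<otimes> \<one> ?N))"
      by (rule coalg_distrib_morphism[symmetric])
        (simp_all add: mult_coalg_morphism)
    then show ?thesis
      by (simp add: Comp_assoc_Arr)
  qed
  finally show "act (tensor_module M N) (x, y, u) \<cdot> (\<one> ?H \<otimes> act (tensor_module M N) (y, z, u))
      = act (tensor_module M N) (x, z, u) \<cdot> (?m \<otimes> \<one> (mob (tensor_module M N) (z, u)))"
    by (simp add: Comp_assoc_Arr tensA_Id)
next
  fix x y assume [simp]: "x \<in> X" "y \<in> X"
  let ?M = "mob M (x, y)" and ?N = "mob N (x, y)" and ?u = "unit A x"
  \<comment> \<open>Since \<open>\<sigma>\<close> of the unit coalgebra is an identity,
    compatibility with the coalgebra morphism \<open>?u\<close> says that \<open>?u\<close> is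
    simply duplicated.\<close>
  have "coalg_distrib V (hom_coalg A x x) ?M ?N \<cdot> (?u \<otimes> (\<one> ?M \<otimes> \<one> ?N))
      = ?u \<otimes> \<one> ?M \<otimes> (?u \<otimes> \<one> ?N)"
    using coalg_distrib_morphism[OF _ _ _ unit_coalg_morphism[of x], of ?M ?N]
    by (simp add: coalg_distrib_unit) (simp add: unit_coalg_def Id_in_Hom)
  then show "act (tensor_module M N) (x, x, y) \<cdot> (?u \<otimes> \<one> (mob (tensor_module M N) (x, y)))
      = \<one> (mob (tensor_module M N) (x, y))"
    using left_module.act_unit[OF M, of x y] left_module.act_unit[OF N, of x y]
    by (simp add: Comp_assoc_Arr tensA_Id[symmetric] interchange del: tensA_assoc)
qed

section \<open>Strict associativity and unit laws for modules\<close>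

lemma vmod_eqI:
  assumes "left_module V X A M" "left_module V X A N" "mob M = mob N"
    and "\<And>x y z. \<lbrakk>x \<in> X; y \<in> X; z \<in> X\<rbrakk> \<Longrightarrow> act M (x, y, z) = act N (x, y, z)"
  shows "M = N"
proof -
  \<comment> \<open>Both actions are extensional, so agreement on triples from \<open>X\<close>
    determines them. This is what permits equalities, and not just isomorphisms, between tensor
    products of modules.\<close>
  have "act M = act N"
    using left_module.act_extensional[OF assms(1)] left_module.act_extensional[OF assms(2)] assms(4)
    by (intro extensionalityI[where A = "X \<times> X \<times> X"]) auto
  then show ?thesis
    using assms(3) by (simp add: vmod.equality)
qed

text \<open>Splitting off the three actions leaves exactly the two iterated distributions compared
  in \<open>coalg_distrib_assoc\<close>.\<close>

lemma tensor_module_assoc: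
  assumes M [simp]: "left_module V X A M" and N [simp]: "left_module V X A N"
    and P [simp]: "left_module V X A P"
  shows "tensor_module (tensor_module M N) P = tensor_module M (tensor_module N P)"
proof (rule vmod_eqI)
  show "mob (tensor_module (tensor_module M N) P) = mob (tensor_module M (tensor_module N P))"
    by (auto simp: family_category_simps fun_eq_iff)
next
  fix x y z assume [simp]: "x \<in> X" "y \<in> X" "z \<in> X"
  let ?C = "hom_coalg A x y" and ?H = "hob A (x, y)"
  let ?M = "mob M (y, z)" and ?N = "mob N (y, z)" and ?P = "mob P (y, z)"
  let ?p = "act M (x, y, z)" and ?q = "act N (x, y, z)" and ?r = "act P (x, y, z)"
  have "((?p \<otimes> ?q) \<cdot> coalg_distrib V ?C ?M ?N) \<otimes> ?r
      = (?p \<otimes> ?q \<otimes> ?r) \<cdot> (coalg_distrib V ?C ?M ?N \<otimes> (\<one> ?H \<otimes> \<one> ?P))"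
    by (simp add: interchange tensA_Id del: tensA_assoc)
  moreover have "?p \<otimes> ((?q \<otimes> ?r) \<cdot> coalg_distrib V ?C ?N ?P)
      = (?p \<otimes> (?q \<otimes> ?r)) \<cdot> ((\<one> ?H \<otimes> \<one> ?M) \<otimes> coalg_distrib V ?C ?N ?P)"
    by (simp add: interchange tensA_Id del: tensA_assoc)
  ultimately show "act (tensor_module (tensor_module M N) P) (x, y, z)
      = act (tensor_module M (tensor_module N P)) (x, y, z)"
    using coalg_distrib_assoc[of ?C ?M ?N ?P] by (simp add: Comp_assoc_Arr)
qed (simp_all add: left_module_tensor)

lemma unit_tensor_module:
  assumes M [simp]: "left_module V X A M"
  shows "tensor_module unit_module M = M"
proof (rule vmod_eqI)
  show "mob (tensor_module unit_module M) = mob M"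
    using left_module.mob_in_Obj[OF M]
    by (auto simp: family_category_simps fun_eq_iff PiE_def extensional_def)
next
  fix x y z assume [simp]: "x \<in> X" "y \<in> X" "z \<in> X"
  show "act (tensor_module unit_module M) (x, y, z) = act M (x, y, z)"
    using counit_coalg_distrib_left[of "hom_coalg A x y"] left_module.act_in_Hom[OF M, of x y z]
    by simp
qed (simp_all add: left_module_tensor left_module_unit)

lemma tensor_module_unit:
  assumes M [simp]: "left_module V X A M"
  shows "tensor_module M unit_module = M"
proof (rule vmod_eqI)
  show "mob (tensor_module M unit_module) = mob M"
    using left_module.mob_in_Obj[OF M]
    by (auto simp: family_category_simps fun_eq_iff PiE_def extensional_def)
next
  fix x y z assume [simp]: "x \<in> X" "y \<in> X" "z \<in> X"
  show "act (tensor_module M unit_module) (x, y, z) = act M (x, y, z)"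
    using counit_coalg_distrib_right[of "hom_coalg A x y"] left_module.act_in_Hom[OF M, of x y z]
    by simp
qed (simp_all add: left_module_tensor left_module_unit)

section \<open>Morphisms of left modules\<close>

lemma module_morphismD:
  assumes "module_morphism V X A M N \<phi>"
  shows "left_module V X A M" "left_module V X A N" "\<phi> \<in> Hom F (mob M) (mob N)"
    and "\<lbrakk>x \<in> X; y \<in> X; z \<in> X\<rbrakk> \<Longrightarrow>
      \<phi> (x, z) \<cdot> act M (x, y, z) = act N (x, y, z) \<cdot> (\<one> (hob A (x, y)) \<otimes> \<phi> (y, z))"
    and "\<lbrakk>x \<in> X; y \<in> X\<rbrakk> \<Longrightarrow> \<phi> (x, y) \<in> Arr V"
    and "\<lbrakk>x \<in> X; y \<in> X\<rbrakk> \<Longrightarrow> Dom V (\<phi> (x, y)) = mob M (x, y)"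
    and "\<lbrakk>x \<in> X; y \<in> X\<rbrakk> \<Longrightarrow> Cod V (\<phi> (x, y)) = mob N (x, y)"
  using assms by (auto simp: module_morphism_def Hom_family_category dest: HomD)

lemma module_morphism_Id:
  assumes M [simp]: "left_module V X A M"
  shows "module_morphism V X A M M (\<one>\<^bsub>F\<^esub> (mob M))"
  using left_module.mob_in_Obj[OF M] family.Id_in_Hom[of "mob M"]
  by (simp add: module_morphism_def tensA_Id)

lemma module_morphism_Comp:
  assumes \<phi>: "module_morphism V X A M N \<phi>" and \<psi>: "module_morphism V X A N P \<psi>"
  shows "module_morphism V X A M P (\<psi> \<cdot>\<^bsub>F\<^esub> \<phi>)"
  unfolding module_morphism_def
proof (intro conjI ballI)
  note [simp] = module_morphismD[OF \<phi>] module_morphismD[OF \<psi>]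
  show "\<psi> \<cdot>\<^bsub>F\<^esub> \<phi> \<in> Hom F (mob M) (mob P)"
    by (rule family.Comp_in_Hom[of _ _ "mob N"]) simp_all
  fix x y z assume [simp]: "x \<in> X" "y \<in> X" "z \<in> X"
  \<comment> \<open>The law for \<open>\<psi>\<close> is held back so that both sides meet at
    \<open>\<psi>\<close> after the action of \<open>N\<close>; it is used in the next step.\<close>
  have "\<psi> (x, z) \<cdot> \<phi> (x, z) \<cdot> act M (x, y, z)
      = \<psi> (x, z) \<cdot> act N (x, y, z) \<cdot> (\<one> (hob A (x, y)) \<otimes> \<phi> (y, z))"
    by (simp add: Comp_assoc_Arr del: module_morphismD(4)[OF \<psi>])
  then show "(\<psi> \<cdot>\<^bsub>F\<^esub> \<phi>) (x, z) \<cdot> act M (x, y, z)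
      = act P (x, y, z) \<cdot> (\<one> (hob A (x, y)) \<otimes> (\<psi> \<cdot>\<^bsub>F\<^esub> \<phi>) (y, z))"
    by (simp add: Comp_assoc_Arr interchange)
qed (use \<phi> \<psi> in \<open>auto dest: module_morphismD\<close>)

text \<open>Tensoring the two morphism laws handles the actions, and naturality of
  \<open>\<sigma>\<close> in both module arguments handles the distribution.\<close>

lemma module_morphism_tensor:
  assumes \<phi>: "module_morphism V X A M M' \<phi>" and \<psi>: "module_morphism V X A N N' \<psi>"
  shows "module_morphism V X A (tensor_module M N) (tensor_module M' N') (\<phi> \<otimes>\<^bsub>F\<^esub> \<psi>)"
  unfolding module_morphism_def
proof (intro conjI ballI)
  note \<phi>D [simp] = module_morphismD[OF \<phi>]
  note \<psi>D [simp] = module_morphismD[OF \<psi>]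
  show "left_module V X A (tensor_module M N)" "left_module V X A (tensor_module M' N')"
    by (simp_all add: left_module_tensor)
  show "\<phi> \<otimes>\<^bsub>F\<^esub> \<psi> \<in> Hom F (mob (tensor_module M N)) (mob (tensor_module M' N'))"
    using family.tensA_in_Hom by simp
  fix x y z assume [simp]: "x \<in> X" "y \<in> X" "z \<in> X"
  let ?C = "hom_coalg A x y" and ?H = "hob A (x, y)"
  let ?M = "mob M (y, z)" and ?N = "mob N (y, z)"
  have "(\<phi> (x, z) \<otimes> \<psi> (x, z)) \<cdot> (act M (x, y, z) \<otimes> act N (x, y, z))
      = (act M' (x, y, z) \<otimes> act N' (x, y, z)) \<cdot> (\<one> ?H \<otimes> \<phi> (y, z) \<otimes> (\<one> ?H \<otimes> \<psi> (y, z)))"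
    by (simp add: interchange del: tensA_assoc)
  then have "(\<phi> (x, z) \<otimes> \<psi> (x, z)) \<cdot> ((act M (x, y, z) \<otimes> act N (x, y, z)) \<cdot> coalg_distrib V ?C ?M ?N)
      = (act M' (x, y, z) \<otimes> act N' (x, y, z))
        \<cdot> ((\<one> ?H \<otimes> \<phi> (y, z) \<otimes> (\<one> ?H \<otimes> \<psi> (y, z))) \<cdot> coalg_distrib V ?C ?M ?N)"
    by (simp add: Comp_assoc_Arr[symmetric])
  also have "\<one> ?H \<otimes> \<phi> (y, z) \<otimes> (\<one> ?H \<otimes> \<psi> (y, z)) \<cdot> coalg_distrib V ?C ?M ?N
      = coalg_distrib V ?C (mob M' (y, z)) (mob N' (y, z)) \<cdot> (\<one> ?H \<otimes> (\<phi> (y, z) \<otimes> \<psi> (y, z)))"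
    using coalg_distrib_natural[of ?C "\<phi> (y, z)" ?M "mob M' (y, z)" "\<psi> (y, z)" ?N "mob N' (y, z)"]
    by (simp add: HomI)
  finally show "(\<phi> \<otimes>\<^bsub>F\<^esub> \<psi>) (x, z) \<cdot> act (tensor_module M N) (x, y, z)
      = act (tensor_module M' N') (x, y, z) \<cdot> (\<one> ?H \<otimes> (\<phi> \<otimes>\<^bsub>F\<^esub> \<psi>) (y, z))"
    by (simp add: Comp_assoc_Arr)
qed

section \<open>The monoidal category of left modules\<close>

definition module_monoidal :: "(('x, 'o, 'm) vmod, ('x, 'o, 'm) vmod_arr) monoidal_category" where
  "module_monoidal = category.extend (module_category V X A)
     (monoidal_category.fields tensor_module
       (\<lambda>(M, \<phi>, M') (N, \<psi>, N'). (tensor_module M N, \<phi> \<otimes>\<^bsub>F\<^esub> \<psi>, tensor_module M' N'))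
       unit_module
       (\<lambda>M N P. \<one>\<^bsub>module_category V X A\<^esub> (tensor_module M (tensor_module N P)))
       \<one>\<^bsub>module_category V X A\<^esub> \<one>\<^bsub>module_category V X A\<^esub>)"

text \<open>The monoidal structure was attached by \<open>category.extend\<close>, which leaves the
  underlying category fields untouched.\<close>

lemma truncate_module_monoidal: "category.truncate module_monoidal = module_category V X A"
  by (simp add: module_monoidal_def category.defs monoidal_category.defs)

lemma module_monoidal_simps [simp]:
  "Obj module_monoidal = {M. left_module V X A M}"
  "Arr module_monoidal = {(M, \<phi>, N). module_morphism V X A M N \<phi>}"
  "Dom module_monoidal (M, \<phi>, N) = M" "Cod module_monoidal (M, \<phi>, N) = N"
  "\<one>\<^bsub>module_monoidal\<^esub> M = (M, \<one>\<^bsub>F\<^esub> (mob M), M)"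
  "(N', \<psi>, P) \<cdot>\<^bsub>module_monoidal\<^esub> (M, \<phi>, N) = (M, \<psi> \<cdot>\<^bsub>F\<^esub> \<phi>, P)"
  "M \<otimes>\<^sub>o\<^bsub>module_monoidal\<^esub> N = tensor_module M N"
  "(M, \<phi>, M') \<otimes>\<^bsub>module_monoidal\<^esub> (N, \<psi>, N') = (tensor_module M N, \<phi> \<otimes>\<^bsub>F\<^esub> \<psi>, tensor_module M' N')"
  "\<k>\<^bsub>module_monoidal\<^esub> = unit_module"
  "assoc module_monoidal M N P = \<one>\<^bsub>module_monoidal\<^esub> (tensor_module M (tensor_module N P))"
  "lunit module_monoidal M = \<one>\<^bsub>module_monoidal\<^esub> M" "runit module_monoidal M = \<one>\<^bsub>module_monoidal\<^esub> M"
  by (simp_all add: module_monoidal_def category.defs monoidal_category.defs module_category_def)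

lemma Hom_module_monoidal: "f \<in> Hom module_monoidal M N \<longleftrightarrow> (\<exists>\<phi>. f = (M, \<phi>, N) \<and> module_morphism V X A M N \<phi>)"
  by (cases f) (auto simp: Hom_def)

lemma category_module_monoidal: "category module_monoidal"
  by unfold_locales
    (auto simp: Hom_module_monoidal module_morphism_Id module_morphism_Comp
      family.Comp_Id[OF module_morphismD(3)] family.Id_Comp[OF module_morphismD(3)]
      family.Comp_assoc[OF module_morphismD(3) module_morphismD(3) module_morphismD(3)]
      dest: module_morphismD(1,2))

lemma family_strict:
  "\<lbrakk>\<phi> \<in> Arr F; \<psi> \<in> Arr F; \<chi> \<in> Arr F\<rbrakk> \<Longrightarrow> (\<phi> \<otimes>\<^bsub>F\<^esub> \<psi>) \<otimes>\<^bsub>F\<^esub> \<chi> = \<phi> \<otimes>\<^bsub>F\<^esub> (\<psi> \<otimes>\<^bsub>F\<^esub> \<chi>)"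
  "\<phi> \<in> Arr F \<Longrightarrow> \<one>\<^bsub>F\<^esub> \<k>\<^bsub>F\<^esub> \<otimes>\<^bsub>F\<^esub> \<phi> = \<phi>"
  "\<phi> \<in> Arr F \<Longrightarrow> \<phi> \<otimes>\<^bsub>F\<^esub> \<one>\<^bsub>F\<^esub> \<k>\<^bsub>F\<^esub> = \<phi>"
  "\<lbrakk>M \<in> Obj F; N \<in> Obj F; P \<in> Obj F\<rbrakk>
    \<Longrightarrow> assoc F M N P = \<one>\<^bsub>F\<^esub> (M \<otimes>\<^sub>o\<^bsub>F\<^esub> N \<otimes>\<^sub>o\<^bsub>F\<^esub> P)"
  "M \<in> Obj F \<Longrightarrow> lunit F M = \<one>\<^bsub>F\<^esub> M"
  "M \<in> Obj F \<Longrightarrow> runit F M = \<one>\<^bsub>F\<^esub> M"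
  by (auto simp: family_category_def PiE_def Pi_def fun_eq_iff restrict_def extensional_def
      strict_assoc strict_lunit strict_runit)

lemma module_morphism_Arr: "module_morphism V X A M N \<phi> \<Longrightarrow> \<phi> \<in> Arr F"
  by (auto dest: module_morphismD HomD)

text \<open>An arrow is a triple, so each strictness law on arrows splits into laws for its domain
  and codomain modules and one for the family between them, the latter coming from
  \<open>family_strict\<close>.\<close>

lemma monoidal_module_monoidal: "monoidal_category module_monoidal"
proof (rule strict_monoidal_categoryI[OF category_module_monoidal], goal_cases)
  case 4
  then show ?case
    by (auto simp: Hom_module_monoidal dest!: module_morphismD(3) intro!: family.tensA_Comp)
next
  case (3 M N)
  then show ?case
    using left_module.mob_in_Obj[of V X A] family.tensA_Id[of "mob M" "mob N"] by simp
qed (auto simp: Hom_module_monoidal left_module_tensor left_module_unit module_morphism_tensor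
    tensor_module_assoc unit_tensor_module tensor_module_unit family_strict
    module_morphism_Arr
    tensor_module_assoc[OF module_morphismD(1) module_morphismD(1) module_morphismD(1)]
    tensor_module_assoc[OF module_morphismD(2) module_morphismD(2) module_morphismD(2)]
    unit_tensor_module[OF module_morphismD(1)] unit_tensor_module[OF module_morphismD(2)]
    tensor_module_unit[OF module_morphismD(1)] tensor_module_unit[OF module_morphismD(2)])

text \<open>The family underlying a tensor product of modules is by definition the tensor product of
  the families, and similarly for the unit, so identities serve as comparison arrows and each
  coherence law equates identities.\<close>

lemma strong_monoidal_forget:
  "strong_monoidal_functor module_monoidal F forget_obj forget_arr
     (\<lambda>M N. \<one>\<^bsub>F\<^esub> (mob M \<otimes>\<^sub>o\<^bsub>F\<^esub> mob N)) (\<one>\<^bsub>F\<^esub> \<k>\<^bsub>F\<^esub>)"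
proof -
  interpret module: monoidal_category module_monoidal by (rule monoidal_module_monoidal)
  have mob: "mob M \<in> Obj F" if "left_module V X A M" for M
    using left_module.mob_in_Obj[OF that] .
  \<comment> \<open>Membership in \<open>Obj F\<close> has to stay folded so that it matches the
    typing rules of \<open>F\<close> as a monoidal category.\<close>
  note [simp del] = Obj_family_category
  note [simp] = mob forget_obj_def forget_arr_def
  show ?thesis
  proof
    fix M N P assume "M \<in> Obj module_monoidal" "N \<in> Obj module_monoidal" "P \<in> Obj module_monoidal"
    then have [simp]: "mob M \<in> Obj F" "mob N \<in> Obj F" "mob P \<in> Obj F"
      and "left_module V X A M" "left_module V X A N" "left_module V X A P"
      by simp_all
    \<comment> \<open>Associativity for the families is read off from the equality of modules by
      applying \<open>mob\<close>.\<close>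
    have [simp]: "mob M \<otimes>\<^sub>o\<^bsub>F\<^esub> mob N \<otimes>\<^sub>o\<^bsub>F\<^esub> mob P = mob M \<otimes>\<^sub>o\<^bsub>F\<^esub> (mob N \<otimes>\<^sub>o\<^bsub>F\<^esub> mob P)"
      using arg_cong[OF tensor_module_assoc[of M N P], of mob] \<open>left_module V X A M\<close>
        \<open>left_module V X A N\<close> \<open>left_module V X A P\<close> by simp
    show "forget_arr (assoc module_monoidal M N P) \<cdot>\<^bsub>F\<^esub>
        (\<one>\<^bsub>F\<^esub> (mob (M \<otimes>\<^sub>o\<^bsub>module_monoidal\<^esub> N) \<otimes>\<^sub>o\<^bsub>F\<^esub> mob P)
          \<cdot>\<^bsub>F\<^esub> (\<one>\<^bsub>F\<^esub> (mob M \<otimes>\<^sub>o\<^bsub>F\<^esub> mob N) \<otimes>\<^bsub>F\<^esub> \<one>\<^bsub>F\<^esub> (forget_obj P)))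
      = \<one>\<^bsub>F\<^esub> (mob M \<otimes>\<^sub>o\<^bsub>F\<^esub> mob (N \<otimes>\<^sub>o\<^bsub>module_monoidal\<^esub> P))
          \<cdot>\<^bsub>F\<^esub> ((\<one>\<^bsub>F\<^esub> (forget_obj M) \<otimes>\<^bsub>F\<^esub> \<one>\<^bsub>F\<^esub> (mob N \<otimes>\<^sub>o\<^bsub>F\<^esub> mob P))
            \<cdot>\<^bsub>F\<^esub> assoc F (forget_obj M) (forget_obj N) (forget_obj P))"
      by (simp add: family_strict family.tensA_Id)
  next
    fix M assume "M \<in> Obj module_monoidal"
    then have [simp]: "mob M \<in> Obj F" and M: "left_module V X A M"
      by simp_all
    have [simp]: "\<k>\<^bsub>F\<^esub> \<otimes>\<^sub>o\<^bsub>F\<^esub> mob M = mob M" "mob M \<otimes>\<^sub>o\<^bsub>F\<^esub> \<k>\<^bsub>F\<^esub> = mob M"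
      using arg_cong[OF unit_tensor_module[OF M], of mob]
        arg_cong[OF tensor_module_unit[OF M], of mob] by simp_all
    show "forget_arr (lunit module_monoidal M) \<cdot>\<^bsub>F\<^esub> (\<one>\<^bsub>F\<^esub> (mob \<k>\<^bsub>module_monoidal\<^esub> \<otimes>\<^sub>o\<^bsub>F\<^esub> mob M)
        \<cdot>\<^bsub>F\<^esub> (\<one>\<^bsub>F\<^esub> \<k>\<^bsub>F\<^esub> \<otimes>\<^bsub>F\<^esub> \<one>\<^bsub>F\<^esub> (forget_obj M))) = lunit F (forget_obj M)"
      "forget_arr (runit module_monoidal M) \<cdot>\<^bsub>F\<^esub> (\<one>\<^bsub>F\<^esub> (mob M \<otimes>\<^sub>o\<^bsub>F\<^esub> mob \<k>\<^bsub>module_monoidal\<^esub>)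
        \<cdot>\<^bsub>F\<^esub> (\<one>\<^bsub>F\<^esub> (forget_obj M) \<otimes>\<^bsub>F\<^esub> \<one>\<^bsub>F\<^esub> \<k>\<^bsub>F\<^esub>)) = runit F (forget_obj M)"
      by (simp_all add: family_strict)
  next
    fix f g M M' N N' assume "f \<in> Hom module_monoidal M M'" "g \<in> Hom module_monoidal N N'"
    then obtain \<phi> \<psi> where fg: "f = (M, \<phi>, M')" "g = (N, \<psi>, N')"
      and "module_morphism V X A M M' \<phi>" "module_morphism V X A N N' \<psi>"
      by (auto simp: Hom_module_monoidal)
    then have "\<phi> \<in> Hom F (mob M) (mob M')" "\<psi> \<in> Hom F (mob N) (mob N')"
      by (auto dest: module_morphismD(3))
    note [simp] = this[THEN HomD(1)] this[THEN HomD(2)] this[THEN HomD(3)]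
    show "\<one>\<^bsub>F\<^esub> (mob M' \<otimes>\<^sub>o\<^bsub>F\<^esub> mob N') \<cdot>\<^bsub>F\<^esub> (forget_arr f \<otimes>\<^bsub>F\<^esub> forget_arr g)
        = forget_arr (f \<otimes>\<^bsub>module_monoidal\<^esub> g) \<cdot>\<^bsub>F\<^esub> \<one>\<^bsub>F\<^esub> (mob M \<otimes>\<^sub>o\<^bsub>F\<^esub> mob N)"
      by (simp add: fg)
  qed (auto simp: Hom_module_monoidal family.iso_arr_Id family.Id_in_Hom dest: module_morphismD(3))
qed

end

theorem proposition3p2:
  fixes V :: "('o, 'm, 'z) braided_category_scheme"
    and X :: "'x set"
    and A :: "('x, 'o, 'm, 'y) cvcat_scheme"
  assumes "strict_braided_monoidal_category V"
    and "cv_category V X A"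
  shows "\<exists>W :: (('x, 'o, 'm) vmod, ('x, 'o, 'm) vmod_arr) monoidal_category.
           category.truncate W = module_category V X A \<and>
           monoidal_category W \<and>
           (\<exists>F2 F0. strong_monoidal_functor W (family_category V X) forget_obj forget_arr F2 F0)"
proof -
  interpret strict_braided_cv_category V X A
    using assms by (rule strict_braided_cv_category.intro)
  show ?thesis
    using truncate_module_monoidal monoidal_module_monoidal strong_monoidal_forget by blast
qed

end
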